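(* Let $\alpha\in(0,1)$ and let $S(\alpha)$ be a positive $\alpha$-stable random variable. Then $S(\alpha)^{\alpha}$ is a positive self-decomposable random variable.
   Context: A positive $\alpha$-stable random variable $S(\alpha)$, $\alpha\in(0,1)$, is a random variable on $(0,\infty)$ with Laplace transform $\mathbb{E}[e^{-\lambda S(\alpha)}]=e^{-\lambda^\alpha}$, $\lambda\ge0$; with this normalization $\mathbb{E}[S(\alpha)^{-\alpha n}]=\Gamma(n+1)/\Gamma(\alpha n+1)$ for $n=1,2,\ldots$. A random variable $X$ is self-decomposable if for every $c\in(0,1)$ there is a random variable $Y_c$ independent of $X$ such that $X\stackrel{(d)}{=}cX+Y_c$, where $\stackrel{(d)}{=}$ denotes equality in distribution. *)

theory Defs
  imports "HOL-Probability.Probability"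
begin

definition positive_rv :: "'a measure \<Rightarrow> ('a \<Rightarrow> real) \<Rightarrow> bool" where
  "positive_rv M X \<longleftrightarrow> prob_space M \<and> X \<in> borel_measurable M \<and> (AE \<omega> in M. 0 < X \<omega>)"

definition positive_stable_rv :: "real \<Rightarrow> 'a measure \<Rightarrow> ('a \<Rightarrow> real) \<Rightarrow> bool" where
  "positive_stable_rv \<alpha> M S \<longleftrightarrow>
     positive_rv M S \<and>
     (\<forall>l::real. l \<ge> 0 \<longrightarrow>
        prob_space.expectation M (\<lambda>\<omega>. exp (- l * S \<omega>)) = exp (- (l powr \<alpha>)))"

text \<open>
  Self-decomposability depends only on the law of \<open>X\<close>, and the space \<open>M\<close> carrying \<open>X\<close> need not be
  rich enough to carry an independent \<open>Y\<close>. So \<open>c X + Y\<close> is formed from a copy \<open>X'\<close> of \<open>X\<close> on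
  some probability space \<open>N\<close>. Taking the sample space of \<open>N\<close> to be the plane is no restriction:
  replace any other \<open>N\<close> by the joint law of \<open>(X', Y)\<close>.
\<close>

definition self_decomposable :: "'a measure \<Rightarrow> ('a \<Rightarrow> real) \<Rightarrow> bool" where
  "self_decomposable M X \<longleftrightarrow>
     prob_space M \<and> X \<in> borel_measurable M \<and>
     (\<forall>c::real. 0 < c \<and> c < 1 \<longrightarrow>
        (\<exists>(N :: (real \<times> real) measure) X' Y.
           prob_space N \<and>
           prob_space.indep_var N borel X' borel Y \<and>
           distr N borel X' = distr M borel X \<and>
           distr M borel X = distr N borel (\<lambda>\<omega>. c * X' \<omega> + Y \<omega>)))"

end

theory Submission
  imports Defs "HOL-Real_Asymp.Real_Asymp"
begin

text \<open>
  Let \<open>X = S powr \<alpha>\<close> and \<open>\<phi> x = E (exp (- x X))\<close>. By the Hausdorff moment problem it suffices that the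
  sequence \<open>\<phi> k / \<phi> (c k)\<close> is completely monotone: it is then the moment sequence of a variable
  \<open>T\<close> in \<open>[0, 1]\<close>, and comparing moments gives \<open>exp (- c X') T = exp (- X)\<close> in law for independent
  \<open>X'\<close> and \<open>T\<close>, so that \<open>Y = - ln T\<close>. For complete monotonicity consider \<open>\<Phi>\<^sub>l t = \<phi> (l t powr - \<alpha>)\<close>.
  Taking Laplace transforms in \<open>t\<close> shows that the integral of \<open>(t - s) powr (\<alpha> - 1) s \<Phi>\<^sub>l' s\<close> over
  \<open>[0, t]\<close> equals \<open>\<Gamma>(\<alpha>) \<alpha>\<^sup>2 l\<close> times the integral of \<open>\<Phi>\<^sub>l s / s\<close>. This operator satisfies a maximum
  principle, which applies inductively to the alternating differences in \<open>l\<close> of \<open>\<Phi>\<^sub>l t / \<Phi>\<^sub>l b\<close>;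
  the choice \<open>t = 1\<close>, \<open>b = c powr (- 1 / \<alpha>)\<close> yields the claim.
\<close>

section \<open>Moment problems on the unit interval\<close>

text \<open>The fractional equation comes from scaling. \<open>\<Phi> l t\<close> is the mean of
  \<open>exp (- l * w powr - \<alpha>)\<close> at \<open>w = t / S\<close>, so substituting
  \<open>t = S * w\<close> in a Laplace integral at \<open>m\<close> leaves only means of
  exponentials of \<open>- m * w * S\<close>, which are explicit. For \<open>\<Phi> l t / t\<close>
  the Jacobian \<open>S\<close> cancels; for \<open>t * \<Phi>' l t\<close> it survives and
  contributes \<open>m powr (\<alpha> - 1)\<close>. The kernel contributes
  \<open>m powr - \<alpha>\<close>, and the product \<open>1 / m\<close> is the symbol of
  integration. The equation is linear in \<open>\<Phi> l\<close> and \<open>l\<close> enters only as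
  a factor, so differences in \<open>l\<close> satisfy it up to one lower-order term. Dividing by
  \<open>\<Phi> l b\<close> makes the value at \<open>b\<close> equal to 1 for every
  \<open>l\<close>; differences of positive order then vanish at 0 and at \<open>b\<close>, as a
  maximum principle requires. The obstacle is \<open>l = 0\<close>: \<open>\<phi>\<close> is
  differentiated only at positive arguments and \<open>1 / s\<close> is not integrable at 0.
  Everything therefore runs with \<open>l > 0\<close>, and integer arguments are reached by a
  limit.\<close>

lemma moments_determine_distribution:
  fixes M N :: "real measure"
  assumes M: "real_distribution M" and N: "real_distribution N"
    and M01: "AE x in M. x \<in> {0..1}" and N01: "AE x in N. x \<in> {0..1}"
    and eq: "\<And>k::nat. (\<integral>x. x ^ k \<partial>M) = (\<integral>x. x ^ k \<partial>N)"
  shows "M = N"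
proof (rule Levy_uniqueness[OF M N], rule ext)
  fix t :: real
  \<comment> \<open>All absolute moments are at most 1 here, so the Taylor remainder of the
    characteristic function is at most \<open>2 * \<bar>t\<bar> ^ n / fact n\<close>. This tends to
    0, hence the moments fix the characteristic function.\<close>
  have char_approx: "norm (char P t - (\<Sum>k\<le>n. ((\<i> * t)^k / fact k) * (\<integral>x. x^k \<partial>P)))
      \<le> 2 * \<bar>t\<bar> ^ n / fact n" if P: "real_distribution P" "AE x in P. x \<in> {0..1}" for P n
  proof -
    interpret P: real_distribution P by (rule P(1))
    have AE1: "AE x in P. norm (x ^ k) \<le> 1" for k
      using P(2) by eventually_elim (auto simp: power_le_one)
    have int: "integrable P (\<lambda>x. x ^ k)" for k
      by (rule P.integrable_const_bound[OF AE1]) simp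
    have "(\<integral>x. \<bar>x\<bar> ^ n \<partial>P) \<le> (\<integral>x. 1 \<partial>P)"
      using AE1[of n] integrable_abs[OF int[of n]]
      by (intro integral_mono_AE) (simp_all add: power_abs)
    then have *: "(\<integral>x. \<bar>x\<bar> ^ n \<partial>P) \<le> 1" using P.prob_space by simp
    have "norm (char P t - (\<Sum>k\<le>n. ((\<i> * t)^k / fact k) * (\<integral>x. x^k \<partial>P)))
      \<le> 2 * \<bar>t\<bar> ^ n / fact n * (\<integral>x. \<bar>x\<bar> ^ n \<partial>P)"
      using P.char_approx1[of n t] int by simp
    also have "\<dots> \<le> 2 * \<bar>t\<bar> ^ n / fact n * 1"
      using * by (intro mult_left_mono) auto
    finally show ?thesis by simp
  qed
  have "norm (char M t - char N t) \<le> 4 * (\<bar>t\<bar> ^ n / fact n)" for n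
  proof -
    define s where "s = (\<Sum>k\<le>n. ((\<i> * t)^k / fact k) * (\<integral>x. x^k \<partial>M))"
    have "norm (char M t - char N t) \<le> norm (char M t - s) + norm (char N t - s)"
      using norm_triangle_ineq4[of "char M t - s" "char N t - s"] by simp
    also have "\<dots> \<le> 2 * \<bar>t\<bar> ^ n / fact n + 2 * \<bar>t\<bar> ^ n / fact n"
      using char_approx[OF M M01, of n] char_approx[OF N N01, of n]
      by (intro add_mono) (simp_all add: s_def eq)
    finally show ?thesis by simp
  qed
  moreover have "(\<lambda>n. 4 * (\<bar>t\<bar> ^ n / fact n)) \<longlonglongrightarrow> 4 * 0"
    using summable_LIMSEQ_zero[OF summable_exp[of "\<bar>t\<bar>"]]
    by (intro tendsto_mult_left) (simp add: field_simps)
  ultimately have "norm (char M t - char N t) \<le> 0"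
    by (intro LIMSEQ_le_const[of _ "0"]) auto
  then show "char M t = char N t" by simp
qed

text \<open>The sign convention is the one that suits moments: if \<open>a\<close> is the moment
  sequence of a law on \<open>[0, 1]\<close>, then \<open>alt_diff a n k\<close> is the mean of
  \<open>x ^ k * (1 - x) ^ n\<close>.\<close>

definition alt_diff :: "(nat \<Rightarrow> real) \<Rightarrow> nat \<Rightarrow> nat \<Rightarrow> real" where
  "alt_diff a n k = (\<Sum>j\<le>n. (-1) ^ j * real (n choose j) * a (k + j))"

lemma alt_diff_0 [simp]: "alt_diff a 0 k = a k"
  by (simp add: alt_diff_def)

lemma alt_diff_Suc: "alt_diff a (Suc n) k = alt_diff a n k - alt_diff a n (Suc k)"
proof -
  have "alt_diff a (Suc n) k = a k + (\<Sum>j\<le>n. (-1) ^ Suc j * real (Suc n choose Suc j) * a (Suc k + j))"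
    unfolding alt_diff_def by (subst sum.atMost_Suc_shift) simp
  also have "(\<Sum>j\<le>n. (-1) ^ Suc j * real (Suc n choose Suc j) * a (Suc k + j)) =
     (\<Sum>j\<le>n. (-1) ^ Suc j * real (n choose Suc j) * a (Suc k + j)) - alt_diff a n (Suc k)"
    unfolding alt_diff_def sum_subtractf[symmetric]
    by (rule sum.cong) (simp_all add: algebra_simps)
  also have "a k + ((\<Sum>j\<le>n. (-1) ^ Suc j * real (n choose Suc j) * a (Suc k + j)) - alt_diff a n (Suc k))
     = (\<Sum>j\<le>Suc n. (-1) ^ j * real (n choose j) * a (k + j)) - alt_diff a n (Suc k)"
    by (simp only: sum.atMost_Suc_shift) simp
  also have "(\<Sum>j\<le>Suc n. (-1) ^ j * real (n choose j) * a (k + j)) = alt_diff a n k"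
    by (simp add: alt_diff_def)
  finally show ?thesis .
qed

text \<open>For a moment sequence this is the binomial expansion of \<open>(x + (1 - x)) ^ n\<close>
  against \<open>x ^ j\<close>; Pascal's rule in the induction gives it for every sequence. With
  \<open>j = 0\<close> it says that the Bernstein weights have total mass
  \<open>a 0\<close>.\<close>

lemma sum_choose_alt_diff: "(\<Sum>k\<le>n. real (n choose k) * alt_diff a (n - k) (k + j)) = a j"
proof (induction n arbitrary: j)
  case (Suc n)
  have "(\<Sum>k\<le>Suc n. real (Suc n choose k) * alt_diff a (Suc n - k) (k + j)) =
     alt_diff a (Suc n) j + (\<Sum>k\<le>n. real (Suc n choose Suc k) * alt_diff a (n - k) (Suc k + j))"
    by (subst sum.atMost_Suc_shift) simp
  also have "(\<Sum>k\<le>n. real (Suc n choose Suc k) * alt_diff a (n - k) (Suc k + j)) =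
     (\<Sum>k\<le>n. real (n choose k) * alt_diff a (n - k) (k + Suc j)) +
     (\<Sum>k\<le>n. real (n choose Suc k) * alt_diff a (n - k) (Suc k + j))"
    by (simp add: sum.distrib[symmetric] algebra_simps)
  also have "(\<Sum>k\<le>n. real (n choose k) * alt_diff a (n - k) (k + Suc j)) = a (Suc j)"
    by (rule Suc.IH)
  also have "alt_diff a (Suc n) j + (a (Suc j) + (\<Sum>k\<le>n. real (n choose Suc k) * alt_diff a (n - k) (Suc k + j))) =
     a (Suc j) + (\<Sum>k\<le>Suc n. real (n choose k) * alt_diff a (Suc n - k) (k + j))"
    by (subst sum.atMost_Suc_shift) simp
  also have "(\<Sum>k\<le>Suc n. real (n choose k) * alt_diff a (Suc n - k) (k + j)) =
     (\<Sum>k\<le>n. real (n choose k) * (alt_diff a (n - k) (k + j) - alt_diff a (n - k) (k + Suc j)))"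
    by (simp add: Suc_diff_le alt_diff_Suc)
  also have "\<dots> = a j - a (Suc j)"
    using Suc.IH[of j] Suc.IH[of "Suc j"] by (simp add: algebra_simps sum_subtractf)
  finally show ?case by simp
qed simp

text \<open>Since \<open>(n choose k) * (k choose j) = (n choose j) * ((n - j) choose (k -
  j))\<close>, the extra factor only shifts the previous identity. Normalised factorial moments of
  the Bernstein weights are thus exactly \<open>a j\<close>, whereas the means of
  \<open>(k / n) ^ j\<close> are so only approximately.\<close>

lemma sum_choose_alt_diff_choose:
  assumes "j \<le> n"
  shows "(\<Sum>k\<le>n. real (n choose k) * alt_diff a (n - k) k * (real (k choose j) / real (n choose j))) = a j"
proof -
  define m where "m = n - j"
  have n: "n = m + j" using assms by (simp add: m_def)
  have "(\<Sum>k\<le>n. real (n choose k) * alt_diff a (n - k) k * (real (k choose j) / real (n choose j)))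
     = (\<Sum>k\<in>{j..m + j}. real (n choose k) * alt_diff a (n - k) k * (real (k choose j) / real (n choose j)))"
    unfolding n by (rule sum.mono_neutral_right) (auto simp: binomial_eq_0)
  also have "\<dots> = (\<Sum>i\<in>{0..m}. real (n choose (i + j)) * alt_diff a (n - (i + j)) (i + j) * (real ((i + j) choose j) / real (n choose j)))"
    using sum.shift_bounds_cl_nat_ivl[of _ 0 j m] by simp
  also have "\<dots> = (\<Sum>i\<in>{0..m}. real (m choose i) * alt_diff a (m - i) (i + j))"
  proof (rule sum.cong)
    fix i assume i: "i \<in> {0..m}"
    have "real (n choose (i + j)) * real ((i + j) choose j) = real (n choose j) * real (m choose i)"
      unfolding of_nat_mult[symmetric] using i n
      by (subst choose_mult) auto
    then show "real (n choose (i + j)) * alt_diff a (n - (i + j)) (i + j) * (real ((i + j) choose j) / real (n choose j))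
       = real (m choose i) * alt_diff a (m - i) (i + j)"
      using n by (simp add: field_simps)
  qed simp
  also have "\<dots> = a j" by (simp add: atLeast0AtMost sum_choose_alt_diff)
  finally show ?thesis .
qed

text \<open>Both terms are products of \<open>j\<close> factors, \<open>(k - i) / (n - i)\<close>
  against \<open>k / n\<close>, so their distance is at most the sum of the distances of the
  factors. The condition \<open>2 * j < n\<close> keeps the factors within \<open>[-1, 1]\<close>
  even where \<open>k < i\<close>.\<close>

lemma choose_quotient_approx:
  assumes "k \<le> n" "2 * j < n"
  shows "\<bar>real (k choose j) / real (n choose j) - (real k / real n) ^ j\<bar> \<le> real j * (real j / (real n - real j))"
proof -
  have eq: "real (m choose j) = (\<Prod>i<j. (real m - real i)) / fact j" for m
    by (simp add: binomial_gbinomial gbinomial_prod_rev lessThan_atLeast0)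
  have "real (k choose j) / real (n choose j) = (\<Prod>i<j. (real k - real i) / (real n - real i))"
    by (simp add: eq prod_dividef)
  moreover have "\<bar>(\<Prod>i<j. (real k - real i) / (real n - real i)) - (\<Prod>i<j. real k / real n)\<bar>
     \<le> (\<Sum>i<j. \<bar>(real k - real i) / (real n - real i) - real k / real n\<bar>)"
  proof (rule norm_prod_diff[where 'a = real, unfolded real_norm_def])
    fix i assume "i \<in> {..<j}"
    then show "\<bar>(real k - real i) / (real n - real i)\<bar> \<le> 1" "\<bar>real k / real n\<bar> \<le> 1"
      using assms by (auto simp: abs_le_iff divide_simps)
  qed
  moreover have "(\<Sum>i<j. \<bar>(real k - real i) / (real n - real i) - real k / real n\<bar>) \<le> (\<Sum>i<j. real j / (real n - real j))"
  proof (rule sum_mono)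
    fix i assume i: "i \<in> {..<j}"
    have "(real k - real i) / (real n - real i) - real k / real n = - (real i / (real n - real i)) * (1 - real k / real n)"
      using i assms by (simp add: field_simps)
    then have "\<bar>(real k - real i) / (real n - real i) - real k / real n\<bar> = real i / (real n - real i) * (1 - real k / real n)"
      using i assms by (simp add: abs_mult)
    also have "\<dots> \<le> real j / (real n - real j) * 1"
      using i assms by (intro mult_mono frac_le) auto
    finally show "\<bar>(real k - real i) / (real n - real i) - real k / real n\<bar> \<le> real j / (real n - real j)" by simp
  qed
  ultimately show ?thesis by simp
qed

text \<open>The weights \<open>(n choose k) * alt_diff a (n - k) k\<close> form a law on the grid of
  points \<open>k / n\<close> whose moments tend to \<open>a\<close>. These laws live on a fixed
  bounded interval, hence are tight, and a weak limit point solves the problem.\<close>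

theorem hausdorff_moment_problem:
  fixes a :: "nat \<Rightarrow> real"
  assumes a0: "a 0 = 1" and nonneg: "\<And>n k. 0 \<le> alt_diff a n k"
  obtains M :: "real measure" where "real_distribution M" "AE x in M. x \<in> {0..1}"
    "\<And>k. (\<integral>x. x ^ k \<partial>M) = a k"
proof -
  define w where "w n k = (if k \<le> n then real (n choose k) * alt_diff a (n - k) k else 0)" for n k
  have w_nonneg: "0 \<le> w n k" for n k by (simp add: w_def nonneg)
  have w_sum: "(\<Sum>k\<le>n. w n k) = 1" for n
    using sum_choose_alt_diff[of n a 0] a0 by (simp add: w_def)
  define p where "p n = embed_pmf (w n)" for n
  have pmf_p: "pmf (p n) k = w n k" for n k
    unfolding p_def
  proof (rule pmf_embed_pmf)
    have "(\<integral>\<^sup>+ k. ennreal (w n k) \<partial>count_space UNIV) = (\<Sum>k\<le>n. ennreal (w n k))"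
      by (rule nn_integral_count_space') (auto simp: w_def)
    then show "(\<integral>\<^sup>+ k. ennreal (w n k) \<partial>count_space UNIV) = 1"
      by (simp add: sum_ennreal w_nonneg w_sum)
  qed (rule w_nonneg)
  have supp: "k \<le> n" if "k \<in> set_pmf (p n)" for n k
    using that by (auto simp: set_pmf_eq pmf_p w_def split: if_splits)
  define \<mu> where "\<mu> n = distr (p n) borel (\<lambda>k. real k / real n)" for n
  have int_\<mu>: "(\<integral>x. f x \<partial>\<mu> n) = (\<Sum>k\<le>n. f (real k / real n) * w n k)"
    if "f \<in> borel_measurable borel" for f :: "real \<Rightarrow> real" and n
  proof -
    have "(\<integral>x. f x \<partial>\<mu> n) = (\<integral>k. f (real k / real n) \<partial>p n)"
      unfolding \<mu>_def using that by (intro integral_distr) auto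
    also have "\<dots> = (\<Sum>k\<in>{..n}. f (real k / real n) * pmf (p n) k)"
      by (rule integral_measure_pmf_real) (auto dest: supp)
    finally show ?thesis by (simp add: pmf_p)
  qed
  have rd: "real_distribution (\<mu> n)" for n
    unfolding \<mu>_def by (intro prob_space.real_distribution_distr prob_space_measure_pmf) auto
  \<comment> \<open>Tightness is defined by intervals open on the left, so this one starts below 0
    in order to contain a possible atom at 0.\<close>
  have mass: "measure (\<mu> n) {-1<..1} = 1" for n
  proof -
    interpret real_distribution "\<mu> n" by (rule rd)
    have "AE x in \<mu> n. x \<in> {-1<..1}"
      unfolding \<mu>_def by (subst AE_distr_iff) (auto simp: AE_measure_pmf_iff divide_le_eq_1 dest!: supp intro: order_less_le_trans[of _ 0])
    then show ?thesis by (subst prob_eq_1) auto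
  qed
  have "tight \<mu>"
    unfolding tight_def using rd mass by (intro conjI allI impI exI[of _ "-1"] exI[of _ 1]) auto
  then obtain r M where r: "strict_mono (r :: nat \<Rightarrow> nat)" and M: "real_distribution M" and wc: "weak_conv_m (\<mu> \<circ> r) M"
    using tight_imp_convergent_subsubsequence[of \<mu> id] by (auto simp: strict_mono_def)
  interpret M: real_distribution M by (rule M)
  \<comment> \<open>Clipping to \<open>[0, 1]\<close> turns powers into bounded continuous test
    functions, as weak convergence requires. It also avoids locating the support of
    \<open>M\<close>: the solution is the image of \<open>M\<close> under \<open>cl\<close>.\<close>
  define cl where "cl x = max 0 (min 1 x)" for x :: real
  have cl01: "0 \<le> cl x" "cl x \<le> 1" for x by (auto simp: cl_def)
  have cl_meas [measurable]: "cl \<in> borel_measurable borel" unfolding cl_def by measurable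
  have moment_M: "(\<integral>x. cl x ^ j \<partial>M) = a j" for j
  proof -
    have "(\<lambda>n. \<integral>x. cl x ^ j \<partial>(\<mu> \<circ> r) n) \<longlonglongrightarrow> (\<integral>x. cl x ^ j \<partial>M)"
      by (rule weak_conv_imp_integral_bdd_continuous_conv[OF _ M wc, where B = 1])
         (use rd cl01 in \<open>auto simp: power_le_one cl_def intro!: continuous_intros\<close>)
    moreover have "(\<lambda>n. \<integral>x. cl x ^ j \<partial>\<mu> n) \<longlonglongrightarrow> a j"
    proof (rule LIM_zero_cancel, rule tendsto_rabs_zero_cancel,
        rule tendsto_sandwich[of "\<lambda>_. 0" _ _ "\<lambda>n. real j * (real j / (real n - real j))"])
      show "\<forall>\<^sub>F n in sequentially. \<bar>(\<integral>x. cl x ^ j \<partial>\<mu> n) - a j\<bar> \<le> real j * (real j / (real n - real j))"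
        using eventually_gt_at_top[of "2 * j"]
      proof eventually_elim
        case (elim n)
        have "(\<integral>x. cl x ^ j \<partial>\<mu> n) = (\<Sum>k\<le>n. w n k * (real k / real n) ^ j)"
          using elim by (subst int_\<mu>) (auto simp: cl_def mult.commute intro!: sum.cong arg_cong2[where f = "(*)"])
        moreover have "a j = (\<Sum>k\<le>n. w n k * (real (k choose j) / real (n choose j)))"
          using sum_choose_alt_diff_choose[of j n a] elim by (simp add: w_def)
        ultimately have "\<bar>(\<integral>x. cl x ^ j \<partial>\<mu> n) - a j\<bar> =
           \<bar>\<Sum>k\<le>n. w n k * (real (k choose j) / real (n choose j) - (real k / real n) ^ j)\<bar>"
          by (simp add: sum_subtractf right_diff_distrib abs_minus_commute)
        also have "\<dots> \<le> (\<Sum>k\<le>n. \<bar>w n k * (real (k choose j) / real (n choose j) - (real k / real n) ^ j)\<bar>)"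
          by (rule sum_abs)
        also have "\<dots> \<le> (\<Sum>k\<le>n. w n k * (real j * (real j / (real n - real j))))"
          unfolding abs_mult abs_of_nonneg[OF w_nonneg] using elim
          by (intro sum_mono mult_left_mono choose_quotient_approx w_nonneg) auto
        also have "\<dots> = real j * (real j / (real n - real j))"
          by (simp only: sum_distrib_right[symmetric] w_sum mult_1)
        finally show ?case .
      qed
      show "(\<lambda>n. real j * (real j / (real n - real j))) \<longlonglongrightarrow> 0" by real_asymp
    qed auto
    then have "(\<lambda>n. \<integral>x. cl x ^ j \<partial>(\<mu> \<circ> r) n) \<longlonglongrightarrow> a j"
      using r unfolding comp_def by (rule LIMSEQ_subseq_LIMSEQ[unfolded comp_def])
    ultimately show ?thesis by (rule LIMSEQ_unique)
  qed
  show thesis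
  proof (rule that[of "distr M borel cl"])
    show "real_distribution (distr M borel cl)" by (rule M.real_distribution_distr) simp
    show "AE x in distr M borel cl. x \<in> {0..1}" by (subst AE_distr_iff) (auto simp: cl01)
    show "(\<integral>x. x ^ k \<partial>distr M borel cl) = a k" for k by (subst integral_distr) (auto simp: moment_M)
  qed
qed

section \<open>Laplace transforms\<close>

lemma power_le_fact_mult_exp:
  fixes u :: real
  assumes "0 \<le> u"
  shows "u ^ k \<le> fact k * exp u"
proof -
  have s: "(\<lambda>n. u ^ n / fact n) sums exp u"
    using exp_converges[of u] by (simp add: divide_inverse mult.commute)
  have "(\<Sum>n\<in>{k}. u ^ n / fact n) \<le> (\<Sum>n. u ^ n / fact n)"
    using assms by (intro sum_le_suminf) (auto intro: sums_summable[OF s])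
  then show ?thesis using sums_unique[OF s] by (simp add: field_simps)
qed

lemma power_mult_exp_le:
  fixes u x :: real
  assumes "0 \<le> u" "0 < x"
  shows "u ^ k * exp (- x * u) \<le> fact k / x ^ k"
  using power_le_fact_mult_exp[of "x * u" k] assms
  by (simp add: power_mult_distrib exp_minus field_simps)

lemma abs_exp_diff_linear_le:
  fixes z :: real
  shows "\<bar>exp z - 1 - z\<bar> \<le> z\<^sup>2 * exp \<bar>z\<bar>"
proof -
  obtain t where t: "\<bar>t\<bar> \<le> \<bar>z\<bar>" "exp z = (\<Sum>m<2. z ^ m / fact m) + exp t / fact 2 * z ^ 2"
    using Maclaurin_exp_le[of z 2] by blast
  then have "\<bar>exp z - 1 - z\<bar> = z\<^sup>2 * (exp t / 2)" by (simp add: numeral_2_eq_2)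
  also have "\<dots> \<le> z\<^sup>2 * exp \<bar>z\<bar>"
  proof (rule mult_left_mono)
    have "exp t \<le> exp \<bar>z\<bar>" using t by simp
    then show "exp t / 2 \<le> exp \<bar>z\<bar>" using exp_gt_zero[of t] by linarith
  qed simp
  finally show ?thesis .
qed

context prob_space
begin

lemma integrable_power_mult_exp:
  assumes [measurable]: "X \<in> borel_measurable M" and nn: "AE \<omega> in M. 0 \<le> X \<omega>" and "0 < (x::real)"
  shows "integrable M (\<lambda>\<omega>. X \<omega> ^ k * exp (- x * X \<omega>))"
proof (rule integrable_const_bound)
  show "AE \<omega> in M. norm (X \<omega> ^ k * exp (- x * X \<omega>)) \<le> fact k / x ^ k"
    using nn by eventually_elim (use power_mult_exp_le[OF _ \<open>0 < x\<close>] in \<open>auto simp: abs_mult power_abs\<close>)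
qed simp

text \<open>For \<open>\<bar>h\<bar> < x / 2\<close> the second-order Taylor remainder carries a
  factor \<open>exp (\<bar>h\<bar> * X \<omega>)\<close>, which half of the decay
  \<open>exp (- x * X \<omega>)\<close> absorbs. The error of the difference quotient is then
  \<open>\<bar>h\<bar>\<close> times a damped moment at \<open>x / 2\<close>, finite whatever the
  moments of \<open>X\<close> are.\<close>

lemma has_real_derivative_laplace_moment:
  assumes [measurable]: "X \<in> borel_measurable M" and nn: "AE \<omega> in M. 0 \<le> X \<omega>" and x: "0 < (x::real)"
  shows "((\<lambda>x. expectation (\<lambda>\<omega>. X \<omega> ^ k * exp (- x * X \<omega>))) has_real_derivative
     - expectation (\<lambda>\<omega>. X \<omega> ^ Suc k * exp (- x * X \<omega>))) (at x)"
proof -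
  define f where "f k x = expectation (\<lambda>\<omega>. X \<omega> ^ k * exp (- x * X \<omega>))" for k x
  note int = integrable_power_mult_exp[OF assms(1) nn]
  have bound: "\<bar>(f k (x + h) - f k x) / h - - f (Suc k) x\<bar> \<le> \<bar>h\<bar> * f (k + 2) (x / 2)"
    if h: "h \<noteq> 0" "\<bar>h\<bar> < x / 2" for h
  proof -
    have i: "integrable M (\<lambda>\<omega>. X \<omega> ^ k * exp (- (x + h) * X \<omega>))"
      "integrable M (\<lambda>\<omega>. X \<omega> ^ k * exp (- x * X \<omega>))"
      "integrable M (\<lambda>\<omega>. h * (X \<omega> ^ Suc k * exp (- x * X \<omega>)))"
      "integrable M (\<lambda>\<omega>. h\<^sup>2 * (X \<omega> ^ (k + 2) * exp (- (x / 2) * X \<omega>)))"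
      using x h by (intro integrable_mult_right int; simp)+
    let ?d = "\<lambda>\<omega>. X \<omega> ^ k * exp (- (x + h) * X \<omega>) - X \<omega> ^ k * exp (- x * X \<omega>) + h * (X \<omega> ^ Suc k * exp (- x * X \<omega>))"
    have eq: "f k (x + h) - f k x + h * f (Suc k) x = expectation ?d"
      unfolding f_def using i by (simp del: power_Suc)
    have "\<bar>expectation ?d\<bar> \<le> expectation (\<lambda>\<omega>. \<bar>?d \<omega>\<bar>)" by (rule integral_abs_bound)
    also have "\<dots> \<le> expectation (\<lambda>\<omega>. h\<^sup>2 * (X \<omega> ^ (k + 2) * exp (- (x / 2) * X \<omega>)))"
    proof (rule integral_mono_AE)
      show "integrable M (\<lambda>\<omega>. \<bar>?d \<omega>\<bar>)" 
        by (rule integrable_abs, rule Bochner_Integration.integrable_add[OF Bochner_Integration.integrable_diff[OF i(1,2)] i(3)])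
      show "AE \<omega> in M. \<bar>?d \<omega>\<bar> \<le> h\<^sup>2 * (X \<omega> ^ (k + 2) * exp (- (x / 2) * X \<omega>))"
        using nn
      proof eventually_elim
        case (elim \<omega>)
        have "?d \<omega> = X \<omega> ^ k * exp (- x * X \<omega>) * (exp (- h * X \<omega>) - 1 - (- h * X \<omega>))"
          using exp_add[of "- x * X \<omega>" "- h * X \<omega>"] by (simp add: algebra_simps)
        then have "\<bar>?d \<omega>\<bar> = X \<omega> ^ k * exp (- x * X \<omega>) * \<bar>exp (- h * X \<omega>) - 1 - (- h * X \<omega>)\<bar>"
          using elim by (simp add: abs_mult)
        also have "\<dots> \<le> X \<omega> ^ k * exp (- x * X \<omega>) * ((- h * X \<omega>)\<^sup>2 * exp \<bar>- h * X \<omega>\<bar>)"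
          using elim by (intro mult_left_mono abs_exp_diff_linear_le) auto
        also have "\<dots> = h\<^sup>2 * (X \<omega> ^ (k + 2) * exp (- x * X \<omega> + \<bar>h\<bar> * X \<omega>))"
          unfolding exp_add using elim by (simp add: abs_mult power2_eq_square)
        also have "\<dots> \<le> h\<^sup>2 * (X \<omega> ^ (k + 2) * exp (- (x / 2) * X \<omega>))"
        proof (intro mult_left_mono)
          have "(\<bar>h\<bar> - x) * X \<omega> \<le> (- (x / 2)) * X \<omega>" using elim h by (intro mult_right_mono) auto
          then show "exp (- x * X \<omega> + \<bar>h\<bar> * X \<omega>) \<le> exp (- (x / 2) * X \<omega>)" by (simp add: algebra_simps)
        qed (use elim in auto)
        finally show ?case .
      qed
    qed (rule i(4))
    also have "\<dots> = h\<^sup>2 * f (k + 2) (x / 2)" by (simp add: f_def)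
    finally have *: "\<bar>f k (x + h) - f k x + h * f (Suc k) x\<bar> \<le> h\<^sup>2 * f (k + 2) (x / 2)"
      by (simp only: eq)
    have "(f k (x + h) - f k x) / h - - f (Suc k) x = (f k (x + h) - f k x + h * f (Suc k) x) / h"
      using h by (simp add: field_simps)
    also have "\<bar>\<dots>\<bar> \<le> h\<^sup>2 * f (k + 2) (x / 2) / \<bar>h\<bar>"
      using * by (simp add: abs_divide divide_right_mono)
    also have "\<dots> = \<bar>h\<bar> * f (k + 2) (x / 2)"
      using h(1) power2_abs[of h] by (simp add: power2_eq_square field_simps)
    finally show ?thesis .
  qed
  have "((\<lambda>h. (f k (x + h) - f k x) / h - - f (Suc k) x) \<longlongrightarrow> 0) (at 0)"
  proof (rule Lim_null_comparison)
    show "\<forall>\<^sub>F h in at 0. norm ((f k (x + h) - f k x) / h - - f (Suc k) x) \<le> \<bar>h\<bar> * f (k + 2) (x / 2)"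
      unfolding eventually_at using bound x by (auto simp: dist_real_def intro!: exI[of _ "x / 2"])
    show "((\<lambda>h. \<bar>h\<bar> * f (k + 2) (x / 2)) \<longlongrightarrow> 0) (at 0)"
      by (auto intro!: tendsto_eq_intros)
  qed
  then have "(f k has_real_derivative - f (Suc k) x) (at x)"
    unfolding DERIV_def by (rule LIM_zero_cancel)
  then show ?thesis unfolding f_def .
qed

end

text \<open>The weight \<open>exp (- t)\<close> turns \<open>f\<close> and \<open>g\<close> into
  densities with a common finite mass \<open>c\<close>. Pushed to \<open>[0, 1]\<close> by
  \<open>exp (- t)\<close>, their transforms at \<open>Suc n\<close> become \<open>n\<close>-th
  moments, so integer points suffice and uniqueness for moments applies.\<close>

lemma laplace_transform_unique:
  fixes f g :: "real \<Rightarrow> ennreal"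
  assumes [measurable]: "f \<in> borel_measurable borel" "g \<in> borel_measurable borel"
    and eq: "\<And>n::nat. (\<integral>\<^sup>+ t. f t * ennreal (exp (- real (Suc n) * t)) * indicator {0<..} t \<partial>lborel) =
        (\<integral>\<^sup>+ t. g t * ennreal (exp (- real (Suc n) * t)) * indicator {0<..} t \<partial>lborel)"
    and fin: "(\<integral>\<^sup>+ t. f t * ennreal (exp (- t)) * indicator {0<..} t \<partial>lborel) < \<infinity>"
  shows "AE t in lborel. 0 < t \<longrightarrow> f t = g t"
proof -
  define w where "w t = ennreal (exp (- t)) * indicator {0<..} t" for t :: real
  have [measurable]: "w \<in> borel_measurable borel" unfolding w_def by measurable
  define c where "c = (\<integral>\<^sup>+ t. f t * w t \<partial>lborel)"
  have c_f: "c = (\<integral>\<^sup>+ t. f t * w t \<partial>lborel)" and c_g: "c = (\<integral>\<^sup>+ t. g t * w t \<partial>lborel)"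
    using eq[of 0] by (simp_all add: c_def w_def mult.assoc)
  have c_fin: "c < \<infinity>" using fin by (simp add: c_def w_def mult.assoc)
  \<comment> \<open>\<open>d\<close> is 1 when the weighted mass is 0, where nothing can be
    normalised, and \<open>c\<close> otherwise.\<close>
  have AE_D: "AE t in lborel. 0 < t \<longrightarrow> f t = g t" if "AE t in lborel. f t * (w t / d) = g t * (w t / d)" "d < \<infinity>" "d \<noteq> 0" for d
    using that(1)
  proof eventually_elim
    case (elim t)
    show ?case
    proof
      assume "0 < t"
      then have "w t / d \<noteq> 0" "w t / d \<noteq> top"
        using that by (auto simp: w_def ennreal_divide_eq_top_iff ennreal_divide_eq_0_iff)
      then show "f t = g t" using elim by (metis mult_divide_eq_ennreal)
    qed
  qed
  show ?thesis
  proof (cases "c = 0")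
    case True
    then have "AE t in lborel. f t * w t = 0" "AE t in lborel. g t * w t = 0"
      using c_f c_g nn_integral_0_iff_AE[of "\<lambda>t. f t * w t" lborel] nn_integral_0_iff_AE[of "\<lambda>t. g t * w t" lborel] by auto
    then have "AE t in lborel. f t * (w t / 1) = g t * (w t / 1)"
      by eventually_elim (auto simp: divide_ennreal_def mult.assoc[symmetric])
    then show ?thesis by (rule AE_D) auto
  next
    case False
    define P where "P F = density lborel (\<lambda>t. F t * (w t / c))" for F :: "real \<Rightarrow> ennreal"
    define Q where "Q F = distr (P F) borel (\<lambda>t. exp (- t))" for F
    have PP: "prob_space (P F)" if [measurable]: "F \<in> borel_measurable borel" and "c = (\<integral>\<^sup>+ t. F t * w t \<partial>lborel)" for F
    proof
      have "emeasure (P F) (space (P F)) = (\<integral>\<^sup>+ t. F t * w t / c \<partial>lborel)"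
        unfolding P_def by (simp add: emeasure_density ennreal_times_divide)
      also have "\<dots> = c / c" using that by (simp add: nn_integral_divide)
      also have "\<dots> = 1" using False c_fin by (simp add: ennreal_divide_self)
      finally show "emeasure (P F) (space (P F)) = 1" .
    qed
    have QR: "real_distribution (Q F)" if "F \<in> borel_measurable borel" "c = (\<integral>\<^sup>+ t. F t * w t \<partial>lborel)" for F
      unfolding Q_def by (intro prob_space.real_distribution_distr PP that) (simp add: P_def)
    have Q01: "AE x in Q F. x \<in> {0..1}" if [measurable]: "F \<in> borel_measurable borel" for F
      unfolding Q_def P_def
      by (subst AE_distr_iff) (auto simp: AE_density w_def split: split_indicator_asm)
    have Qmom: "(\<integral>x. x ^ k \<partial>Q F) = enn2real ((\<integral>\<^sup>+ t. F t * ennreal (exp (- real (Suc k) * t)) * indicator {0<..} t \<partial>lborel) / c)"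
      if [measurable]: "F \<in> borel_measurable borel" for F k
    proof -
      have "(\<integral>x. x ^ k \<partial>Q F) = (\<integral>t. exp (- t) ^ k \<partial>P F)"
        unfolding Q_def P_def by (subst integral_distr) auto
      also have "\<dots> = enn2real (\<integral>\<^sup>+ t. ennreal (exp (- t) ^ k) \<partial>P F)"
        by (rule integral_eq_nn_integral) (auto simp: P_def)
      also have "(\<integral>\<^sup>+ t. ennreal (exp (- t) ^ k) \<partial>P F) = (\<integral>\<^sup>+ t. F t * (w t / c) * ennreal (exp (- t) ^ k) \<partial>lborel)"
        unfolding P_def by (rule nn_integral_density) auto
      also have "\<dots> = (\<integral>\<^sup>+ t. F t * ennreal (exp (- real (Suc k) * t)) * indicator {0<..} t / c \<partial>lborel)"
      proof (rule nn_integral_cong)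
        fix t :: real
        have "exp (- t) * exp (- t) ^ k = exp (- real (Suc k) * t)"
          by (simp add: exp_of_nat_mult[symmetric] exp_add[symmetric] algebra_simps)
        then have "ennreal (exp (- real (Suc k) * t)) = ennreal (exp (- t)) * ennreal (exp (- t) ^ k)"
          by (metis ennreal_mult exp_ge_zero zero_le_power)
        then show "F t * (w t / c) * ennreal (exp (- t) ^ k) = F t * ennreal (exp (- real (Suc k) * t)) * indicator {0<..} t / c"
          by (simp add: w_def divide_ennreal_def mult_ac)
      qed
      also have "\<dots> = (\<integral>\<^sup>+ t. F t * ennreal (exp (- real (Suc k) * t)) * indicator {0<..} t \<partial>lborel) / c"
        by (rule nn_integral_divide) simp
      finally show ?thesis .
    qed
    have "Q f = Q g"
      by (rule moments_determine_distribution[OF QR QR Q01 Q01]) (simp_all only: assms(1,2) c_f[symmetric] c_g[symmetric] Qmom eq)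
    moreover have "distr (Q F) borel (\<lambda>x. - ln x) = P F" if [measurable]: "F \<in> borel_measurable borel" for F
      unfolding Q_def
      by (subst distr_distr) (auto simp: comp_def P_def intro!: distr_id2)
    ultimately have "P f = P g" by (metis assms(1,2))
    then have "AE t in lborel. f t * (w t / c) = g t * (w t / c)"
      unfolding P_def by (subst (asm) sigma_finite_measure.density_unique_iff[OF sigma_finite_lborel]) simp_all
    then show ?thesis by (rule AE_D) (use c_fin False in auto)
  qed
qed

lemma nn_integral_powr_exp:
  fixes \<beta> m :: real
  assumes "0 < \<beta>" "0 < m"
  shows "(\<integral>\<^sup>+ u. ennreal (u powr (\<beta> - 1) * exp (- m * u)) * indicator {0<..} u \<partial>lborel) = ennreal (Gamma \<beta> * m powr - \<beta>)"
proof -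
  have 1: "(\<integral>\<^sup>+ u. ennreal (u powr (\<beta> - 1) * exp (- u)) * indicator {0<..} u \<partial>lborel) = ennreal (Gamma \<beta>)"
  proof -
    have "((\<lambda>t. t powr (\<beta> - 1) / exp t) has_integral Gamma \<beta>) {0..}" by (rule Gamma_integral_real) fact
    then have "((\<lambda>t. indicator {0..} t * (t powr (\<beta> - 1) * exp (- t))) has_integral Gamma \<beta>) UNIV"
      by (subst (asm) has_integral_restrict_UNIV[symmetric])
         (auto simp: exp_minus divide_inverse elim!: has_integral_eq[rotated])
    then have "(\<integral>\<^sup>+ u. ennreal (indicator {0..} u * (u powr (\<beta> - 1) * exp (- u))) \<partial>lborel) = ennreal (Gamma \<beta>)"
      by (intro nn_integral_has_integral_lborel) auto
    moreover have "(\<integral>\<^sup>+ u. ennreal (u powr (\<beta> - 1) * exp (- u)) * indicator {0<..} u \<partial>lborel) =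
       (\<integral>\<^sup>+ u. ennreal (indicator {0..} u * (u powr (\<beta> - 1) * exp (- u))) \<partial>lborel)"
      by (rule nn_integral_cong) (auto simp: indicator_def)
    ultimately show ?thesis by simp
  qed
  have "ennreal (Gamma \<beta>) = ennreal \<bar>m\<bar> * (\<integral>\<^sup>+ u. ennreal ((0 + m * u) powr (\<beta> - 1) * exp (- (0 + m * u))) * indicator {0<..} (0 + m * u) \<partial>lborel)"
    unfolding 1[symmetric] using assms by (intro nn_integral_real_affine) auto
  also have "\<dots> = ennreal m * (\<integral>\<^sup>+ u. ennreal (m powr (\<beta> - 1)) * (ennreal (u powr (\<beta> - 1) * exp (- m * u)) * indicator {0<..} u) \<partial>lborel)"
  proof (rule arg_cong2[where f = "(*)"], use assms in simp, rule nn_integral_cong)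
    fix u :: real
    show "ennreal ((0 + m * u) powr (\<beta> - 1) * exp (- (0 + m * u))) * indicator {0<..} (0 + m * u) =
      ennreal (m powr (\<beta> - 1)) * (ennreal (u powr (\<beta> - 1) * exp (- m * u)) * indicator {0<..} u)"
    proof (cases "0 < u")
      case False
      then show ?thesis using assms by (simp add: zero_less_mult_iff)
    next
      case True
      then have "(0 + m * u) powr (\<beta> - 1) * exp (- (0 + m * u)) = m powr (\<beta> - 1) * (u powr (\<beta> - 1) * exp (- m * u))"
        using assms by (simp add: powr_mult)
      then show ?thesis using assms True by (simp add: ennreal_mult mult.assoc)
    qed
  qed
  also have "\<dots> = ennreal m * (ennreal (m powr (\<beta> - 1)) * (\<integral>\<^sup>+ u. ennreal (u powr (\<beta> - 1) * exp (- m * u)) * indicator {0<..} u \<partial>lborel))"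
    by (subst nn_integral_cmult) auto
  also have "\<dots> = ennreal (m powr \<beta>) * (\<integral>\<^sup>+ u. ennreal (u powr (\<beta> - 1) * exp (- m * u)) * indicator {0<..} u \<partial>lborel)"
    using assms by (simp add: mult.assoc[symmetric] ennreal_mult[symmetric] powr_diff)
  finally have "ennreal (m powr - \<beta>) * ennreal (Gamma \<beta>) = ennreal (m powr - \<beta>) * (ennreal (m powr \<beta>) * (\<integral>\<^sup>+ u. ennreal (u powr (\<beta> - 1) * exp (- m * u)) * indicator {0<..} u \<partial>lborel))"
    by simp
  then show ?thesis
    using assms by (simp add: mult.assoc[symmetric] ennreal_mult[symmetric] powr_add[symmetric] Gamma_real_nonneg mult.commute)
qed

text \<open>With nonnegative integrals the order of integration can be exchanged without
  integrability conditions. The result is used for \<open>\<beta> = \<alpha>\<close>, and for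
  \<open>\<beta> = 1\<close>, where the convolution is plain integration.\<close>

lemma laplace_transform_convolution_powr:
  fixes \<beta> m :: real and h :: "real \<Rightarrow> ennreal"
  assumes \<beta>: "0 < \<beta>" and m: "0 < m" and [measurable]: "h \<in> borel_measurable borel"
  shows "(\<integral>\<^sup>+ t. (\<integral>\<^sup>+ s. ennreal ((t - s) powr (\<beta> - 1)) * h s * indicator {0<..<t} s \<partial>lborel) * ennreal (exp (- m * t)) * indicator {0<..} t \<partial>lborel)
    = ennreal (Gamma \<beta> * m powr - \<beta>) * (\<integral>\<^sup>+ s. h s * ennreal (exp (- m * s)) * indicator {0<..} s \<partial>lborel)"
proof -
  let ?k = "\<lambda>u. ennreal (u powr (\<beta> - 1) * exp (- m * u)) * indicator {0<..} u"
  have "(\<integral>\<^sup>+ t. (\<integral>\<^sup>+ s. ennreal ((t - s) powr (\<beta> - 1)) * h s * indicator {0<..<t} s \<partial>lborel) * ennreal (exp (- m * t)) * indicator {0<..} t \<partial>lborel)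
    = (\<integral>\<^sup>+ t. (\<integral>\<^sup>+ s. ennreal ((t - s) powr (\<beta> - 1)) * h s * indicator {0<..<t} s * ennreal (exp (- m * t)) * indicator {0<..} t \<partial>lborel) \<partial>lborel)"
    by (intro nn_integral_cong, subst nn_integral_multc[symmetric], simp, subst nn_integral_multc) (auto simp: mult_ac nn_integral_multc[symmetric])
  also have "\<dots> = (\<integral>\<^sup>+ t. (\<integral>\<^sup>+ s. h s * ennreal (exp (- m * s)) * indicator {0<..} s * ?k (t - s) \<partial>lborel) \<partial>lborel)"
  proof (intro nn_integral_cong)
    fix t s :: real
    have "ennreal ((t - s) powr (\<beta> - 1)) * ennreal (exp (- m * t)) =
      ennreal (exp (- m * s)) * ennreal ((t - s) powr (\<beta> - 1) * exp (- m * (t - s)))"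
      using exp_add[of "- m * s" "- m * (t - s)"] by (simp add: ennreal_mult[symmetric] algebra_simps)
    then show "ennreal ((t - s) powr (\<beta> - 1)) * h s * indicator {0<..<t} s * ennreal (exp (- m * t)) * indicator {0<..} t =
      h s * ennreal (exp (- m * s)) * indicator {0<..} s * ?k (t - s)"
      by (auto simp: mult_ac split: split_indicator)
  qed
  also have "\<dots> = (\<integral>\<^sup>+ s. (\<integral>\<^sup>+ t. h s * ennreal (exp (- m * s)) * indicator {0<..} s * ?k (t - s) \<partial>lborel) \<partial>lborel)"
    by (rule lborel_pair.Fubini'[symmetric]) simp
  also have "\<dots> = (\<integral>\<^sup>+ s. h s * ennreal (exp (- m * s)) * indicator {0<..} s * (\<integral>\<^sup>+ t. ?k (t - s) \<partial>lborel) \<partial>lborel)"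
    by (intro nn_integral_cong nn_integral_cmult) simp
  also have "\<dots> = (\<integral>\<^sup>+ s. h s * ennreal (exp (- m * s)) * indicator {0<..} s * ennreal (Gamma \<beta> * m powr - \<beta>) \<partial>lborel)"
  proof (rule nn_integral_cong)
    fix s :: real
    have "(\<integral>\<^sup>+ t. ?k t \<partial>lborel) = ennreal \<bar>1\<bar> * (\<integral>\<^sup>+ t. ?k (- s + 1 * t) \<partial>lborel)"
      by (rule nn_integral_real_affine) auto
    then have "(\<integral>\<^sup>+ t. ?k (t - s) \<partial>lborel) = ennreal (Gamma \<beta> * m powr - \<beta>)"
      using nn_integral_powr_exp[OF \<beta> m] by simp
    then show "h s * ennreal (exp (- m * s)) * indicator {0<..} s * (\<integral>\<^sup>+ t. ?k (t - s) \<partial>lborel) =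
      h s * ennreal (exp (- m * s)) * indicator {0<..} s * ennreal (Gamma \<beta> * m powr - \<beta>)" by simp
  qed
  also have "\<dots> = (\<integral>\<^sup>+ s. h s * ennreal (exp (- m * s)) * indicator {0<..} s \<partial>lborel) * ennreal (Gamma \<beta> * m powr - \<beta>)"
    by (rule nn_integral_multc) simp
  finally show ?thesis by (simp add: mult.commute)
qed

section \<open>A maximum principle for a fractional operator\<close>

lemma has_integral_power_kernel:
  fixes a t e :: real
  assumes "0 < a" "e \<le> t"
  shows "((\<lambda>s. (t - s) powr (a - 1)) has_integral ((t - e) powr a / a)) {e..t}"
proof -
  have "((\<lambda>s. (t - s) powr (a - 1)) has_integral (- ((t - t) powr a / a) - - ((t - e) powr a / a))) {e..t}"
    using assms
    by (intro fundamental_theorem_of_calculus_interior continuous_intros continuous_on_powr')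
       (auto intro!: derivative_eq_intros simp: has_real_derivative_iff_has_vector_derivative[symmetric])
  then show ?thesis by simp
qed

lemma power_kernel_integral_le:
  fixes a t e B I :: real
  assumes "0 < a" "e \<le> t"
    and "((\<lambda>s. (t - s) powr (a - 1) * g s) has_integral I) {e..t}"
    and "\<And>s. s \<in> {e..t} \<Longrightarrow> g s \<le> B"
  shows "I \<le> B * ((t - e) powr a / a)"
proof -
  have k: "((\<lambda>s. (t - s) powr (a - 1) * B) has_integral ((t - e) powr a / a * B)) {e..t}"
    by (intro has_integral_mult_left has_integral_power_kernel assms)
  have "I \<le> (t - e) powr a / a * B"
    by (rule has_integral_le[OF assms(3) k]) (auto intro!: mult_left_mono assms(4))
  then show ?thesis by (simp add: mult.commute)
qed

text \<open>
  At an interior maximum \<open>t0\<close>, integration by parts away from the singularity of the kernel shows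
  that the fractional integral cannot grow faster than order \<open>h powr (1 + a)\<close> on \<open>[t0 - h, t0]\<close>.
\<close>

lemma fractional_integral_increment_at_max:
  fixes a b t0 C \<delta> h :: real and V V' J :: "real \<Rightarrow> real"
  assumes a: "0 < a" "a < 1" and t0: "t0 \<le> b" and h: "0 < h" "2 * h < \<delta>" "\<delta> < t0" and C: "C \<ge> 0"
    and contV: "continuous_on {0..b} V"
    and dV: "\<And>s. \<lbrakk>0 < s; s < t0\<rbrakk> \<Longrightarrow> (V has_real_derivative V' s) (at s)"
    and J: "\<And>t. \<lbrakk>0 < t; t \<le> t0\<rbrakk> \<Longrightarrow> ((\<lambda>s. (t - s) powr (a - 1) * (s * V' s)) has_integral J t) {0..t}"
    and max: "\<And>s. \<lbrakk>0 \<le> s; s \<le> t0\<rbrakk> \<Longrightarrow> V s \<le> V t0"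
    and near: "\<And>s. \<lbrakk>t0 - \<delta> < s; s \<le> t0\<rbrakk> \<Longrightarrow> \<bar>V' s\<bar> \<le> C * (t0 - s)"
      "\<And>s. \<lbrakk>t0 - \<delta> < s; s \<le> t0\<rbrakk> \<Longrightarrow> V t0 - V s \<le> C * (t0 - s)\<^sup>2"
  shows "J t0 - J (t0 - h) \<le> (4 * C * t0 + 8 * C * t0 / a) * h powr (1 + a)"
proof -
  \<comment> \<open>Cutting at distance \<open>2 * h\<close> from \<open>t0\<close> keeps both
    kernels nonsingular on \<open>[0, e]\<close>. On the remaining pieces \<open>V'\<close> is of
    order \<open>h\<close> and the kernels have mass of order \<open>h powr a\<close>, which already
    is the claimed order.\<close>
  define e where "e = t0 - 2 * h"
  define t1 where "t1 = t0 - h"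
  have e: "0 < e" "e < t1" "t1 < t0" "t0 - \<delta> < e" using h by (auto simp: e_def t1_def)
  define K where "K s = (t0 - s) powr (a - 1) - (t1 - s) powr (a - 1)" for s
  let ?g = "\<lambda>s. s * V' s"
  let ?k = "\<lambda>t s. (t - s) powr (a - 1) * (s * V' s)"
  have "?k t0 integrable_on {0..t0}" "?k t1 integrable_on {0..t1}"
    using J[of t0] J[of t1] e by (auto simp: integrable_on_def)
  then have io: "?k t0 integrable_on {0..e}" "?k t1 integrable_on {0..e}"
    "?k t0 integrable_on {e..t0}" "?k t1 integrable_on {e..t1}"
    using e by (auto elim!: integrable_on_subinterval)
  define A0 A1 B0 B1 where
    "A0 = integral {0..e} (?k t0)" and "A1 = integral {0..e} (?k t1)" and
    "B0 = integral {e..t0} (?k t0)" and "B1 = integral {e..t1} (?k t1)"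
  have A: "(?k t0 has_integral A0) {0..e}" "(?k t1 has_integral A1) {0..e}"
    and B: "(?k t0 has_integral B0) {e..t0}" "(?k t1 has_integral B1) {e..t1}"
    unfolding A0_def A1_def B0_def B1_def using io by (simp_all add: integrable_integral)
  have J0: "J t0 = A0 + B0"
    using has_integral_combine[OF _ _ A(1) B(1)] J[of t0] e by (auto intro: has_integral_unique)
  have J1: "J t1 = A1 + B1"
    using has_integral_combine[OF _ _ A(2) B(2)] J[of t1] e by (auto intro: has_integral_unique)
  have gB: "\<bar>?g s\<bar> \<le> t0 * (C * (2 * h))" if "s \<in> {e..t0}" for s
  proof -
    have "\<bar>V' s\<bar> \<le> C * (t0 - s)" using that e by (intro near) auto
    also have "\<dots> \<le> C * (2 * h)" using that C by (intro mult_left_mono) (auto simp: e_def)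
    finally show ?thesis using that e by (auto simp: abs_mult intro!: mult_mono)
  qed
  have "B0 \<le> t0 * (C * (2 * h)) * ((t0 - e) powr a / a)"
    by (rule power_kernel_integral_le[OF a(1) _ B(1)]) (use e gB in \<open>auto simp: abs_le_iff\<close>)
  also have "(t0 - e) powr a = 2 powr a * h powr a"
    using h by (simp add: e_def powr_mult)
  also have "t0 * (C * (2 * h)) * (2 powr a * h powr a / a) \<le> t0 * (C * (2 * h)) * (2 * h powr a / a)"
    using a h C e powr_mono[of a 1 "2::real"]
    by (intro mult_left_mono divide_right_mono mult_right_mono) auto
  finally have B0: "B0 \<le> 4 * C * t0 / a * (h * h powr a)" by (simp add: field_simps)
  have "- B1 \<le> t0 * (C * (2 * h)) * ((t1 - e) powr a / a)"
  proof (rule power_kernel_integral_le[OF a(1)])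
    show "((\<lambda>s. (t1 - s) powr (a - 1) * - ?g s) has_integral - B1) {e..t1}"
      using has_integral_neg[OF B(2)] by simp
  qed (use e gB in \<open>auto simp: abs_le_iff\<close>)
  also have "t1 - e = h" by (simp add: t1_def e_def)
  finally have B1: "- B1 \<le> 2 * C * t0 / a * (h * h powr a)" by (simp add: field_simps)

  \<comment> \<open>Integration by parts is applied to \<open>V - V t0\<close> instead of
    \<open>V\<close>. Then \<open>K\<close>, its derivative and \<open>V - V t0\<close> are all
    nonpositive, so the terms beside \<open>K s * (s * V' s)\<close> in the derivative of
    \<open>P\<close> are nonnegative, and the boundary terms of \<open>P\<close> bound
    \<open>A0 - A1\<close> from above.\<close>
  define P where "P s = K s * s * (V s - V t0)" for s
  have dP: "((\<lambda>s. (- (a - 1) * (t0 - s) powr (a - 2) + (a - 1) * (t1 - s) powr (a - 2)) * s * (V s - V t0)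
      + K s * (V s - V t0) + K s * ?g s) has_integral (P e - P 0)) {0..e}"
  proof (rule fundamental_theorem_of_calculus_interior)
    show "continuous_on {0..e} P"
      unfolding P_def K_def using e t0
      by (intro continuous_intros continuous_on_subset[OF contV]) auto
    fix s assume s: "s \<in> {0<..<e}"
    show "(P has_vector_derivative ((- (a - 1) * (t0 - s) powr (a - 2) + (a - 1) * (t1 - s) powr (a - 2)) * s * (V s - V t0)
      + K s * (V s - V t0) + K s * ?g s)) (at s)"
      unfolding P_def K_def has_real_derivative_iff_has_vector_derivative[symmetric] using s e
      by (auto intro!: derivative_eq_intros dV simp: algebra_simps)
  qed (use e in simp)
  have "A0 - A1 \<le> P e - P 0"
  proof (rule has_integral_le[OF has_integral_diff[OF A] dP])
    fix s assume s: "s \<in> {0..e}"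
    have mono: "(t0 - s) powr p \<le> (t1 - s) powr p" if "p \<le> 0" for p
      using s e that by (intro powr_mono2') auto
    have "V s - V t0 \<le> 0" using max[of s] s e by auto
    moreover have "K s \<le> 0" unfolding K_def using mono[of "a - 1"] a by auto
    moreover have "- (a - 1) * (t0 - s) powr (a - 2) + (a - 1) * (t1 - s) powr (a - 2) \<le> 0"
    proof -
      have "(1 - a) * (t0 - s) powr (a - 2) \<le> (1 - a) * (t1 - s) powr (a - 2)"
        using mono[of "a - 2"] a by (intro mult_left_mono) auto
      then show ?thesis by (simp add: algebra_simps)
    qed
    ultimately have "0 \<le> (- (a - 1) * (t0 - s) powr (a - 2) + (a - 1) * (t1 - s) powr (a - 2)) * s * (V s - V t0)
      + K s * (V s - V t0)"
      using s by (intro add_nonneg_nonneg mult_nonpos_nonpos mult_nonpos_nonneg) auto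
    then show "?k t0 s - ?k t1 s \<le> (- (a - 1) * (t0 - s) powr (a - 2) + (a - 1) * (t1 - s) powr (a - 2)) * s * (V s - V t0)
      + K s * (V s - V t0) + K s * ?g s"
      by (simp add: K_def algebra_simps)
  qed
  also have "P 0 = 0" by (simp add: P_def)
  also have "P e - 0 \<le> h powr (a - 1) * t0 * (C * (2 * h)\<^sup>2)"
  proof -
    have "- K e \<le> h powr (a - 1)" by (simp add: K_def e_def t1_def)
    moreover have "V t0 - V e \<le> C * (2 * h)\<^sup>2" using near(2)[of e] e by (simp add: e_def)
    moreover have "0 \<le> V t0 - V e" using max[of e] e by auto
    ultimately have "(- K e) * e * (V t0 - V e) \<le> h powr (a - 1) * t0 * (C * (2 * h)\<^sup>2)"
      using e by (intro mult_mono) auto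
    then show ?thesis by (simp add: P_def algebra_simps)
  qed
  also have "h powr (a - 1) * t0 * (C * (2 * h)\<^sup>2) = 4 * C * t0 * (h * h powr a)"
    using h by (simp add: powr_diff power2_eq_square)
  finally have AA: "A0 - A1 \<le> 4 * C * t0 * (h * h powr a)" .
  \<comment> \<open>Naming the common quantity \<open>E\<close> makes the last estimate linear. The
    8 in the statement rounds up the sum of 4 from \<open>B0\<close> and 2 from
    \<open>B1\<close>.\<close>
  have "0 \<le> C * t0 / a * (h * h powr a)" using a C e h by auto
  moreover define E where "E = C * t0 / a * (h * h powr a)"
  moreover have "4 * C * t0 / a * (h * h powr a) = 4 * E" "2 * C * t0 / a * (h * h powr a) = 2 * E"
    "(4 * C * t0 + 8 * C * t0 / a) * (h * h powr a) = 4 * C * t0 * (h * h powr a) + 8 * E"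
    by (simp_all add: E_def algebra_simps add_divide_distrib)
  ultimately have "J t0 - J t1 \<le> (4 * C * t0 + 8 * C * t0 / a) * (h * h powr a)"
    using J0 J1 AA B0 B1 by linarith
  then show ?thesis using h by (simp add: t1_def powr_add)
qed

text \<open>The boundary values force a positive maximum into the interior. There \<open>V'\<close>
  vanishes and is differentiable, so the previous estimate bounds the left difference quotients of
  \<open>J\<close> by a multiple of \<open>h powr a\<close>; they tend to 0 at most, against a
  positive derivative. The condition on \<open>J\<close> is asked only where \<open>V\<close> is
  positive, since that is where the later induction can supply it.\<close>

lemma fractional_maximum_principle:
  fixes a b :: real and V V' J :: "real \<Rightarrow> real"
  assumes a: "0 < a" "a < 1" and b: "0 < b"
    and contV: "continuous_on {0..b} V" and V0: "V 0 \<le> 0" and Vb: "V b \<le> 0"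
    and dV: "\<And>s. \<lbrakk>0 < s; s < b\<rbrakk> \<Longrightarrow> (V has_real_derivative V' s) (at s)"
    and dV': "\<And>s. \<lbrakk>0 < s; s < b\<rbrakk> \<Longrightarrow> V' differentiable (at s)"
    and J: "\<And>t. \<lbrakk>0 < t; t < b\<rbrakk> \<Longrightarrow> ((\<lambda>s. (t - s) powr (a - 1) * (s * V' s)) has_integral J t) {0..t}"
    and dJ: "\<And>t. \<lbrakk>0 < t; t < b; 0 < V t\<rbrakk> \<Longrightarrow> \<exists>r>0. (J has_real_derivative r) (at t)"
    and t: "t \<in> {0..b}"
  shows "V t \<le> 0"
proof (rule ccontr)
  assume "\<not> V t \<le> 0"
  obtain t0 where t0: "t0 \<in> {0..b}" and max: "\<And>s. s \<in> {0..b} \<Longrightarrow> V s \<le> V t0"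
    using continuous_attains_sup[of "{0..b}" V] contV b by auto
  have pos: "0 < V t0" using max[OF t] \<open>\<not> V t \<le> 0\<close> by auto
  have t0b: "0 < t0" "t0 < b" using t0 pos V0 Vb by (auto simp: less_le)
  have V't0: "V' t0 = 0"
  proof (rule DERIV_local_max[OF dV[OF t0b]])
    show "0 < min t0 (b - t0)" using t0b by simp
    show "\<forall>y. \<bar>t0 - y\<bar> < min t0 (b - t0) \<longrightarrow> V y \<le> V t0"
      using t0b by (auto intro!: max)
  qed
  obtain D where D: "(V' has_real_derivative D) (at t0)"
    using dV'[OF t0b] by (auto simp: real_differentiable_def)
  \<comment> \<open>Close to \<open>t0\<close> the difference quotients of \<open>V'\<close> differ
    from \<open>D\<close> by less than 1, so \<open>C\<close> bounds them.\<close>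
  define C where "C = \<bar>D\<bar> + 1"
  have C: "C > 0" by (simp add: C_def)
  from D have "(\<lambda>h. (V' (t0 + h) - V' t0) / h) \<midarrow>0\<rightarrow> D" by (simp add: DERIV_def)
  then have "\<forall>\<^sub>F h in at 0. dist ((V' (t0 + h) - V' t0) / h) D < 1" by (rule tendstoD) simp
  then obtain d where d: "d > 0" and "\<And>h. \<lbrakk>h \<noteq> 0; dist h 0 < d\<rbrakk> \<Longrightarrow> dist ((V' (t0 + h) - V' t0) / h) D < 1"
    unfolding eventually_at by blast
  then have d': "\<bar>V' (t0 + h) / h\<bar> \<le> C" if "h \<noteq> 0" "\<bar>h\<bar> < d" for h
    using that V't0 by (force simp: dist_real_def C_def)
  define \<delta> where "\<delta> = min d t0 / 2"
  have \<delta>: "0 < \<delta>" "\<delta> < d" "\<delta> < t0" using d t0b by (auto simp: \<delta>_def)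
  have near1: "\<bar>V' s\<bar> \<le> C * (t0 - s)" if "t0 - \<delta> < s" "s \<le> t0" for s
  proof (cases "s = t0")
    case False
    then show ?thesis using d'[of "s - t0"] that \<delta> by (auto simp: abs_divide field_simps)
  qed (simp add: V't0)
  have near2: "V t0 - V s \<le> C * (t0 - s)\<^sup>2" if s: "t0 - \<delta> < s" "s \<le> t0" for s
  proof (cases "s = t0")
    case False
    then have "s < t0" using s by simp
    then obtain z where z: "z > s" "z < t0" "V t0 - V s = (t0 - s) * V' z"
      using MVT2[of s t0 V V'] dV s \<delta> t0b by (metis less_trans order_le_less_trans diff_gt_0_iff_gt order_less_le_trans)
    have "V' z \<le> C * (t0 - z)" using near1[of z] z s by auto
    also have "\<dots> \<le> C * (t0 - s)" using z C by auto
    finally show ?thesis using z(3) \<open>s < t0\<close> by (simp add: power2_eq_square mult.left_commute mult_left_mono)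
  qed simp
  obtain r where r: "r > 0" "(J has_real_derivative r) (at t0)" using dJ[OF t0b pos] by blast
  define Q where "Q = 4 * C * t0 + 8 * C * t0 / a"
  have inc: "(J (t0 + - h) - J t0) / - h \<le> Q * h powr a" if h: "0 < h" "2 * h < \<delta>" for h
  proof -
    have "J t0 - J (t0 - h) \<le> Q * h powr (1 + a)"
      unfolding Q_def
      by (rule fractional_integral_increment_at_max[where \<delta> = \<delta> and V = V and V' = V' and b = b, OF a])
         (use t0b h \<delta> C contV dV J max near1 near2 in auto)
    then show ?thesis using h by (simp add: powr_add field_simps)
  qed
  have "((\<lambda>h. (J (t0 + h) - J t0) / h) \<longlongrightarrow> r) (at 0)"
    using r(2) by (simp add: DERIV_def)
  moreover have "filterlim (\<lambda>h. - h) (at 0) (at_right (0::real))"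
    unfolding filterlim_at by (auto intro!: tendsto_eq_intros eventually_at_rightI[of 0 1])
  ultimately have lim: "((\<lambda>h. (J (t0 + - h) - J t0) / - h) \<longlongrightarrow> r) (at_right 0)"
    by (rule filterlim_compose)
  have "((\<lambda>h. Q * h powr a) \<longlongrightarrow> Q * 0) (at_right 0)"
    using a by (intro tendsto_intros tendsto_zero_powrI[where b = a]) (auto simp: eventually_at_right_less intro!: eventually_mono[OF eventually_at_right_less])
  from this lim have "r \<le> Q * 0"
  proof (rule tendsto_le[rotated])
    show "\<forall>\<^sub>F h in at_right 0. (J (t0 + - h) - J t0) / - h \<le> Q * h powr a"
      using inc \<delta> by (intro eventually_at_rightI[of 0 "\<delta> / 2"]) auto
  qed simp_all
  then show False using r by simp
qed

section \<open>The power of a stable variable\<close>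

text \<open>A null set contains no interval. This yields points arbitrarily close to a given time at
  which an almost everywhere identity holds.\<close>

lemma AE_lborel_obtains_Ioo:
  fixes a b :: real
  assumes "AE t in lborel. P t" "a < b"
  obtains t where "a < t" "t < b" "P t"
proof -
  obtain N where N: "{t \<in> space lborel. \<not> P t} \<subseteq> N" "emeasure lborel N = 0" "N \<in> sets lborel"
    using assms(1) by (rule AE_E)
  have "\<not> {a<..<b} \<subseteq> N"
  proof
    assume "{a<..<b} \<subseteq> N"
    then have "emeasure lborel {a<..<b} \<le> emeasure lborel N" using N by (intro emeasure_mono) auto
    then show False using N assms by simp
  qed
  then obtain t where "t \<in> {a<..<b}" "t \<notin> N" by blast
  then show thesis using N(1) that[of t] by auto
qed

section \<open>Laplace transforms of scale mixtures by the stable variable\<close>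

locale positive_stable = prob_space +
  fixes S :: "'a \<Rightarrow> real" and \<alpha> :: real
  assumes \<alpha>: "0 < \<alpha>" "\<alpha> < 1"
    and S_measurable [measurable]: "S \<in> borel_measurable M"
    and S_pos: "AE \<omega> in M. 0 < S \<omega>"
    and laplace_S: "\<And>l. 0 \<le> l \<Longrightarrow> expectation (\<lambda>\<omega>. exp (- l * S \<omega>)) = exp (- (l powr \<alpha>))"
begin

definition \<phi> :: "real \<Rightarrow> real" where
  "\<phi> x = expectation (\<lambda>\<omega>. exp (- x * S \<omega> powr \<alpha>))"

text \<open>For positive arguments this is minus the derivative of \<open>\<phi>\<close>. At 0 the
  integrand need not be integrable, which is why the analytic facts about it assume
  \<open>0 < x\<close>.\<close>

definition \<psi> :: "real \<Rightarrow> real" where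
  "\<psi> x = expectation (\<lambda>\<omega>. S \<omega> powr \<alpha> * exp (- x * S \<omega> powr \<alpha>))"

lemma \<phi>_measurable [measurable]: "\<phi> \<in> borel_measurable borel"
  unfolding \<phi>_def by measurable

lemma \<psi>_measurable [measurable]: "\<psi> \<in> borel_measurable borel"
  unfolding \<psi>_def by measurable

lemma integrable_exp_S_powr: "0 \<le> x \<Longrightarrow> integrable M (\<lambda>\<omega>. exp (- x * S \<omega> powr \<alpha>))"
  by (rule integrable_const_bound[where B = 1]) auto

lemma integrable_S_powr_exp: "0 < x \<Longrightarrow> integrable M (\<lambda>\<omega>. S \<omega> powr \<alpha> * exp (- x * S \<omega> powr \<alpha>))"
  using integrable_power_mult_exp[of "\<lambda>\<omega>. S \<omega> powr \<alpha>" x 1] by simp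

lemma \<phi>_pos: "0 \<le> x \<Longrightarrow> 0 < \<phi> x"
  unfolding \<phi>_def by (intro expectation_greater integrable_exp_S_powr) auto

lemma \<phi>_0 [simp]: "\<phi> 0 = 1"
  by (simp add: \<phi>_def prob_space)

lemma \<psi>_nonneg: "0 \<le> \<psi> x"
  unfolding \<psi>_def by (rule Bochner_Integration.integral_nonneg) simp

lemma \<phi>_deriv: "0 < x \<Longrightarrow> (\<phi> has_real_derivative - \<psi> x) (at x)"
  using has_real_derivative_laplace_moment[of "\<lambda>\<omega>. S \<omega> powr \<alpha>" x 0] by (simp add: \<phi>_def[abs_def] \<psi>_def)

lemma \<psi>_differentiable: "0 < x \<Longrightarrow> \<psi> differentiable (at x)"
  using has_real_derivative_laplace_moment[of "\<lambda>\<omega>. S \<omega> powr \<alpha>" x 1]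
  by (auto simp: \<psi>_def[abs_def] real_differentiable_def)

lemma \<psi>_isCont: "0 < x \<Longrightarrow> isCont \<psi> x"
  using \<psi>_differentiable differentiable_imp_continuous_within by blast

text \<open>This comes from \<open>u * exp (- u) \<le> 1\<close>. It bounds the function under the
  fractional kernel by \<open>\<alpha>\<close>, which gives both the finiteness and the domination
  used later.\<close>

lemma mult_\<psi>_le_1: "0 < x \<Longrightarrow> x * \<psi> x \<le> 1"
proof -
  assume x: "0 < x"
  have "x * \<psi> x = expectation (\<lambda>\<omega>. x * (S \<omega> powr \<alpha> * exp (- x * S \<omega> powr \<alpha>)))"
    unfolding \<psi>_def by simp
  also have "\<dots> \<le> expectation (\<lambda>\<omega>. 1)"
  proof (intro integral_mono integrable_mult_right integrable_S_powr_exp x)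
    show "x * (S \<omega> powr \<alpha> * exp (- x * S \<omega> powr \<alpha>)) \<le> 1" for \<omega>
      using x power_mult_exp_le[of "S \<omega> powr \<alpha>" x 1] by (simp add: field_simps)
  qed simp
  finally show ?thesis by (simp add: prob_space)
qed

lemma expectation_S_exp:
  assumes "0 < m"
  shows "expectation (\<lambda>\<omega>. S \<omega> * exp (- m * S \<omega>)) = \<alpha> * m powr (\<alpha> - 1) * exp (- (m powr \<alpha>))"
proof -
  have nn: "AE \<omega> in M. 0 \<le> S \<omega>" using S_pos by eventually_elim simp
  have "((\<lambda>x. expectation (\<lambda>\<omega>. exp (- x * S \<omega>))) has_real_derivative - expectation (\<lambda>\<omega>. S \<omega> * exp (- m * S \<omega>))) (at m)"
    using has_real_derivative_laplace_moment[OF _ nn assms, of 0] by simp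
  moreover have "((\<lambda>x. expectation (\<lambda>\<omega>. exp (- x * S \<omega>))) has_real_derivative - (\<alpha> * m powr (\<alpha> - 1) * exp (- (m powr \<alpha>)))) (at m)"
  proof (rule DERIV_cong_ev[THEN iffD2, OF refl _ refl])
    show "\<forall>\<^sub>F x in nhds m. expectation (\<lambda>\<omega>. exp (- x * S \<omega>)) = exp (- (x powr \<alpha>))"
      by (rule eventually_mono[OF eventually_nhds_in_open[of "{0<..}"]], simp_all only: open_greaterThan greaterThan_iff assms)
         (rule laplace_S, simp)
    show "((\<lambda>x. exp (- (x powr \<alpha>))) has_real_derivative - (\<alpha> * m powr (\<alpha> - 1) * exp (- (m powr \<alpha>)))) (at m)"
      using assms by (auto intro!: derivative_eq_intros)
  qed
  ultimately show ?thesis using DERIV_unique by fastforce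
qed

text \<open>Tonelli and the substitution \<open>s = S \<omega> * w\<close> move the random variable
  from \<open>G\<close> to \<open>q\<close>. With an exponential \<open>q\<close> the remaining mean
  is known from the Laplace transform of \<open>S\<close>.\<close>

lemma nn_integral_scale_S:
  fixes q G :: "real \<Rightarrow> ennreal"
  assumes [measurable]: "q \<in> borel_measurable borel" "G \<in> borel_measurable borel"
  shows "(\<integral>\<^sup>+ s. q s * (\<integral>\<^sup>+ \<omega>. G (s / S \<omega>) \<partial>M) * indicator {0<..} s \<partial>lborel) =
     (\<integral>\<^sup>+ w. G w * (\<integral>\<^sup>+ \<omega>. ennreal (S \<omega>) * q (S \<omega> * w) \<partial>M) * indicator {0<..} w \<partial>lborel)"
proof -
  interpret P: pair_sigma_finite lborel M ..
  have "(\<integral>\<^sup>+ s. q s * (\<integral>\<^sup>+ \<omega>. G (s / S \<omega>) \<partial>M) * indicator {0<..} s \<partial>lborel) =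
     (\<integral>\<^sup>+ s. (\<integral>\<^sup>+ \<omega>. q s * indicator {0<..} s * G (s / S \<omega>) \<partial>M) \<partial>lborel)"
    by (simp add: nn_integral_cmult mult_ac)
  also have "\<dots> = (\<integral>\<^sup>+ \<omega>. (\<integral>\<^sup>+ s. q s * indicator {0<..} s * G (s / S \<omega>) \<partial>lborel) \<partial>M)"
    by (rule P.Fubini'[symmetric]) simp
  also have "\<dots> = (\<integral>\<^sup>+ \<omega>. (\<integral>\<^sup>+ w. ennreal (S \<omega>) * (q (S \<omega> * w) * indicator {0<..} w * G w) \<partial>lborel) \<partial>M)"
  proof (rule nn_integral_cong_AE)
    show "AE \<omega> in M. (\<integral>\<^sup>+ s. q s * indicator {0<..} s * G (s / S \<omega>) \<partial>lborel) =
       (\<integral>\<^sup>+ w. ennreal (S \<omega>) * (q (S \<omega> * w) * indicator {0<..} w * G w) \<partial>lborel)"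
      using S_pos
    proof eventually_elim
      case (elim \<omega>)
      have "(\<integral>\<^sup>+ s. q s * indicator {0<..} s * G (s / S \<omega>) \<partial>lborel) =
        ennreal \<bar>S \<omega>\<bar> * (\<integral>\<^sup>+ w. q (0 + S \<omega> * w) * indicator {0<..} (0 + S \<omega> * w) * G ((0 + S \<omega> * w) / S \<omega>) \<partial>lborel)"
        using elim by (intro nn_integral_real_affine) auto
      also have "\<dots> = (\<integral>\<^sup>+ w. ennreal \<bar>S \<omega>\<bar> * (q (0 + S \<omega> * w) * indicator {0<..} (0 + S \<omega> * w) * G ((0 + S \<omega> * w) / S \<omega>)) \<partial>lborel)"
        by (rule nn_integral_cmult[symmetric]) simp
      also have "\<dots> = (\<integral>\<^sup>+ w. ennreal (S \<omega>) * (q (S \<omega> * w) * indicator {0<..} w * G w) \<partial>lborel)"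
        using elim by (intro nn_integral_cong) (auto simp: zero_less_mult_iff split: split_indicator)
      finally show ?case .
    qed
  qed
  also have "\<dots> = (\<integral>\<^sup>+ w. (\<integral>\<^sup>+ \<omega>. ennreal (S \<omega>) * (q (S \<omega> * w) * indicator {0<..} w * G w) \<partial>M) \<partial>lborel)"
    by (rule P.Fubini') simp
  also have "\<dots> = (\<integral>\<^sup>+ w. G w * (\<integral>\<^sup>+ \<omega>. ennreal (S \<omega>) * q (S \<omega> * w) \<partial>M) * indicator {0<..} w \<partial>lborel)"
  proof (rule nn_integral_cong)
    fix w :: real
    have "(\<integral>\<^sup>+ \<omega>. ennreal (S \<omega>) * (q (S \<omega> * w) * indicator {0<..} w * G w) \<partial>M) =
      (\<integral>\<^sup>+ \<omega>. (ennreal (S \<omega>) * q (S \<omega> * w)) * (indicator {0<..} w * G w) \<partial>M)"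
      by (simp add: mult.assoc)
    also have "\<dots> = (\<integral>\<^sup>+ \<omega>. ennreal (S \<omega>) * q (S \<omega> * w) \<partial>M) * (indicator {0<..} w * G w)"
      by (rule nn_integral_multc) simp
    finally show "(\<integral>\<^sup>+ \<omega>. ennreal (S \<omega>) * (q (S \<omega> * w) * indicator {0<..} w * G w) \<partial>M) =
      G w * (\<integral>\<^sup>+ \<omega>. ennreal (S \<omega>) * q (S \<omega> * w) \<partial>M) * indicator {0<..} w"
      by (simp add: mult_ac)
  qed
  finally show ?thesis .
qed

lemma S_quotient_powr:
  assumes "0 < s" "0 < S \<omega>"
  shows "(s / S \<omega>) powr - \<alpha> = s powr - \<alpha> * S \<omega> powr \<alpha>"
  using assms by (simp add: powr_divide powr_minus field_simps)

lemma laplace_transform_\<phi>: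
  assumes l: "0 < l" and m: "0 < m"
  shows "(\<integral>\<^sup>+ s. ennreal (\<phi> (l * s powr - \<alpha>) / s) * ennreal (exp (- m * s)) * indicator {0<..} s \<partial>lborel) =
    (\<integral>\<^sup>+ w. ennreal (exp (- l * w powr - \<alpha>) * exp (- ((m * w) powr \<alpha>)) / w) * indicator {0<..} w \<partial>lborel)"
proof -
  \<comment> \<open>The \<open>1 / s\<close> in \<open>?q\<close> cancels the Jacobian
    \<open>S \<omega>\<close>, so only the mean of \<open>exp (- (m * w) * S \<omega>)\<close>
    remains.\<close>
  let ?q = "\<lambda>s. ennreal (exp (- m * s) / s)" and ?G = "\<lambda>w. ennreal (exp (- l * w powr - \<alpha>))"
  have "(\<integral>\<^sup>+ s. ennreal (\<phi> (l * s powr - \<alpha>) / s) * ennreal (exp (- m * s)) * indicator {0<..} s \<partial>lborel) =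
    (\<integral>\<^sup>+ s. ?q s * (\<integral>\<^sup>+ \<omega>. ?G (s / S \<omega>) \<partial>M) * indicator {0<..} s \<partial>lborel)"
  proof (rule nn_integral_cong)
    fix s :: real
    show "ennreal (\<phi> (l * s powr - \<alpha>) / s) * ennreal (exp (- m * s)) * indicator {0<..} s =
      ?q s * (\<integral>\<^sup>+ \<omega>. ?G (s / S \<omega>) \<partial>M) * indicator {0<..} s"
    proof (cases "0 < s")
      case True
      have "(\<integral>\<^sup>+ \<omega>. ?G (s / S \<omega>) \<partial>M) = (\<integral>\<^sup>+ \<omega>. ennreal (exp (- (l * s powr - \<alpha>) * S \<omega> powr \<alpha>)) \<partial>M)"
        by (rule nn_integral_cong_AE, use S_pos in eventually_elim) (simp add: S_quotient_powr[OF True] mult.assoc)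
      also have "\<dots> = ennreal (\<phi> (l * s powr - \<alpha>))"
        unfolding \<phi>_def using l by (intro nn_integral_eq_integral integrable_exp_S_powr) auto
      finally show ?thesis
        using True l \<phi>_pos[of "l * s powr - \<alpha>"] by (simp add: ennreal_mult[symmetric] mult.commute)
    qed simp
  qed
  also have "\<dots> = (\<integral>\<^sup>+ w. ?G w * (\<integral>\<^sup>+ \<omega>. ennreal (S \<omega>) * ?q (S \<omega> * w) \<partial>M) * indicator {0<..} w \<partial>lborel)"
    by (rule nn_integral_scale_S) auto
  also have "\<dots> = (\<integral>\<^sup>+ w. ennreal (exp (- l * w powr - \<alpha>) * exp (- ((m * w) powr \<alpha>)) / w) * indicator {0<..} w \<partial>lborel)"
  proof (rule nn_integral_cong)
    fix w :: real
    show "?G w * (\<integral>\<^sup>+ \<omega>. ennreal (S \<omega>) * ?q (S \<omega> * w) \<partial>M) * indicator {0<..} w =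
      ennreal (exp (- l * w powr - \<alpha>) * exp (- ((m * w) powr \<alpha>)) / w) * indicator {0<..} w"
    proof (cases "0 < w")
      case True
      have i: "integrable M (\<lambda>\<omega>. exp (- (m * w) * S \<omega>))"
        using S_pos m True by (intro integrable_const_bound[where B = 1]) (auto elim!: eventually_mono)
      have "(\<integral>\<^sup>+ \<omega>. ennreal (S \<omega>) * ?q (S \<omega> * w) \<partial>M) = (\<integral>\<^sup>+ \<omega>. ennreal (exp (- (m * w) * S \<omega>) / w) \<partial>M)"
      proof (rule nn_integral_cong_AE, use S_pos in eventually_elim)
        fix \<omega> assume "0 < S \<omega>"
        then have "S \<omega> * (exp (- m * (S \<omega> * w)) / (S \<omega> * w)) = exp (- (m * w) * S \<omega>) / w"
          by (simp add: mult_ac)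
        then show "ennreal (S \<omega>) * ?q (S \<omega> * w) = ennreal (exp (- (m * w) * S \<omega>) / w)"
          using True \<open>0 < S \<omega>\<close> by (metis ennreal_mult exp_ge_zero divide_nonneg_nonneg less_imp_le mult_nonneg_nonneg)
      qed
      also have "\<dots> = ennreal (expectation (\<lambda>\<omega>. exp (- (m * w) * S \<omega>) / w))"
        using True i by (intro nn_integral_eq_integral) auto
      also have "expectation (\<lambda>\<omega>. exp (- (m * w) * S \<omega>) / w) = exp (- ((m * w) powr \<alpha>)) / w"
        using laplace_S[of "m * w"] True m by simp
      finally show ?thesis using True by (simp add: ennreal_mult[symmetric])
    qed simp
  qed
  finally show ?thesis .
qed

text \<open>The integrand on the left contains \<open>s\<close> times the derivative in
  \<open>s\<close> of \<open>\<phi> (l * s powr - \<alpha>)\<close>. The Jacobian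
  \<open>S \<omega>\<close> now survives, and its mean against the exponential brings in
  \<open>(m * w) powr (\<alpha> - 1)\<close>. The power of \<open>w\<close> combines with
  \<open>w powr - \<alpha>\<close> to \<open>1 / w\<close>, so the same integral as for
  \<open>\<phi>\<close> appears.\<close>

lemma laplace_transform_\<psi>:
  assumes l: "0 < l" and m: "0 < m"
  shows "(\<integral>\<^sup>+ s. ennreal (\<alpha> * (l * s powr - \<alpha> * \<psi> (l * s powr - \<alpha>))) * ennreal (exp (- m * s)) * indicator {0<..} s \<partial>lborel) =
    ennreal (\<alpha>\<^sup>2 * l * m powr (\<alpha> - 1)) *
    (\<integral>\<^sup>+ w. ennreal (exp (- l * w powr - \<alpha>) * exp (- ((m * w) powr \<alpha>)) / w) * indicator {0<..} w \<partial>lborel)"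
proof -
  let ?q = "\<lambda>s. ennreal (exp (- m * s))" and ?G = "\<lambda>w. ennreal (\<alpha> * (l * w powr - \<alpha> * exp (- l * w powr - \<alpha>)))"
  have "(\<integral>\<^sup>+ s. ennreal (\<alpha> * (l * s powr - \<alpha> * \<psi> (l * s powr - \<alpha>))) * ennreal (exp (- m * s)) * indicator {0<..} s \<partial>lborel) =
    (\<integral>\<^sup>+ s. ?q s * (\<integral>\<^sup>+ \<omega>. ?G (s / S \<omega>) \<partial>M) * indicator {0<..} s \<partial>lborel)"
  proof (rule nn_integral_cong)
    fix s :: real
    show "ennreal (\<alpha> * (l * s powr - \<alpha> * \<psi> (l * s powr - \<alpha>))) * ennreal (exp (- m * s)) * indicator {0<..} s =
      ?q s * (\<integral>\<^sup>+ \<omega>. ?G (s / S \<omega>) \<partial>M) * indicator {0<..} s"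
    proof (cases "0 < s")
      case True
      have i: "integrable M (\<lambda>\<omega>. \<alpha> * (l * s powr - \<alpha> * (S \<omega> powr \<alpha> * exp (- (l * s powr - \<alpha>) * S \<omega> powr \<alpha>))))"
        using l True by (intro integrable_mult_right integrable_S_powr_exp) simp
      have "(\<integral>\<^sup>+ \<omega>. ?G (s / S \<omega>) \<partial>M) = (\<integral>\<^sup>+ \<omega>. ennreal (\<alpha> * (l * s powr - \<alpha> * (S \<omega> powr \<alpha> * exp (- (l * s powr - \<alpha>) * S \<omega> powr \<alpha>)))) \<partial>M)"
        by (rule nn_integral_cong_AE, use S_pos in eventually_elim) (simp add: S_quotient_powr[OF True] mult.assoc)
      also have "\<dots> = ennreal (expectation (\<lambda>\<omega>. \<alpha> * (l * s powr - \<alpha> * (S \<omega> powr \<alpha> * exp (- (l * s powr - \<alpha>) * S \<omega> powr \<alpha>)))))"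
        using l \<alpha> i by (intro nn_integral_eq_integral) auto
      also have "\<dots> = ennreal (\<alpha> * (l * s powr - \<alpha> * \<psi> (l * s powr - \<alpha>)))"
        by (simp add: \<psi>_def)
      finally show ?thesis
        by (simp add: mult.commute)
    qed simp
  qed
  also have "\<dots> = (\<integral>\<^sup>+ w. ?G w * (\<integral>\<^sup>+ \<omega>. ennreal (S \<omega>) * ?q (S \<omega> * w) \<partial>M) * indicator {0<..} w \<partial>lborel)"
    by (rule nn_integral_scale_S) auto
  also have "\<dots> = (\<integral>\<^sup>+ w. ennreal (\<alpha>\<^sup>2 * l * m powr (\<alpha> - 1)) * (ennreal (exp (- l * w powr - \<alpha>) * exp (- ((m * w) powr \<alpha>)) / w) * indicator {0<..} w) \<partial>lborel)"
  proof (rule nn_integral_cong)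
    fix w :: real
    show "?G w * (\<integral>\<^sup>+ \<omega>. ennreal (S \<omega>) * ?q (S \<omega> * w) \<partial>M) * indicator {0<..} w =
      ennreal (\<alpha>\<^sup>2 * l * m powr (\<alpha> - 1)) * (ennreal (exp (- l * w powr - \<alpha>) * exp (- ((m * w) powr \<alpha>)) / w) * indicator {0<..} w)"
    proof (cases "0 < w")
      case True
      have nn: "AE \<omega> in M. 0 \<le> S \<omega>" using S_pos by eventually_elim simp
      have i: "integrable M (\<lambda>\<omega>. S \<omega> * exp (- (m * w) * S \<omega>))"
        using integrable_power_mult_exp[OF _ nn, of "m * w" 1] m True by simp
      have "(\<integral>\<^sup>+ \<omega>. ennreal (S \<omega>) * ?q (S \<omega> * w) \<partial>M) = (\<integral>\<^sup>+ \<omega>. ennreal (S \<omega> * exp (- (m * w) * S \<omega>)) \<partial>M)"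
        using S_pos
        by (intro nn_integral_cong_AE)
           (auto elim!: eventually_mono simp: True ennreal_mult[symmetric] mult_ac)
      also have "\<dots> = ennreal (expectation (\<lambda>\<omega>. S \<omega> * exp (- (m * w) * S \<omega>)))"
        using nn i by (intro nn_integral_eq_integral) (auto elim!: eventually_mono)
      also have "expectation (\<lambda>\<omega>. S \<omega> * exp (- (m * w) * S \<omega>)) = \<alpha> * (m * w) powr (\<alpha> - 1) * exp (- ((m * w) powr \<alpha>))"
        using expectation_S_exp[of "m * w"] True m by simp
      finally have *: "(\<integral>\<^sup>+ \<omega>. ennreal (S \<omega>) * ?q (S \<omega> * w) \<partial>M) = ennreal (\<alpha> * (m * w) powr (\<alpha> - 1) * exp (- ((m * w) powr \<alpha>)))" .
      have "w powr - \<alpha> * w powr (\<alpha> - 1) = 1 / w"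
        using powr_add[of w "- \<alpha>" "\<alpha> - 1"] powr_minus_divide[of w 1] True by simp
      moreover have "(\<alpha> * (l * w powr - \<alpha> * exp (- l * w powr - \<alpha>))) * (\<alpha> * (m * w) powr (\<alpha> - 1) * exp (- ((m * w) powr \<alpha>))) =
        (\<alpha>\<^sup>2 * l * m powr (\<alpha> - 1)) * (exp (- l * w powr - \<alpha>) * exp (- ((m * w) powr \<alpha>)) * (w powr - \<alpha> * w powr (\<alpha> - 1)))"
        using True m by (simp add: powr_mult power2_eq_square mult_ac)
      ultimately show ?thesis using True \<alpha> l m by (simp only: *) (simp add: ennreal_mult[symmetric])
    qed simp
  qed
  also have "\<dots> = ennreal (\<alpha>\<^sup>2 * l * m powr (\<alpha> - 1)) *
    (\<integral>\<^sup>+ w. ennreal (exp (- l * w powr - \<alpha>) * exp (- ((m * w) powr \<alpha>)) / w) * indicator {0<..} w \<partial>lborel)"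
    by (rule nn_integral_cmult) simp
  finally show ?thesis .
qed

end

section \<open>The fractional integral equation at every time\<close>

lemma has_integral_Icc_of_nn_integral:
  fixes g :: "real \<Rightarrow> real"
  assumes [measurable]: "g \<in> borel_measurable borel"
    and nn: "\<And>s. \<lbrakk>a < s; s < b\<rbrakk> \<Longrightarrow> 0 \<le> g s"
    and eq: "(\<integral>\<^sup>+ s. ennreal (g s) * indicator {a<..<b} s \<partial>lborel) = ennreal r" and r: "0 \<le> r"
  shows "(g has_integral r) {a..b}"
proof -
  have "((\<lambda>s. indicator {a<..<b} s * g s) has_integral r) UNIV"
  proof (rule nn_integral_has_integral)
    show "0 \<le> indicator {a<..<b} s * g s" for s using nn by (auto simp: indicator_def)
    have "(\<integral>\<^sup>+ s. ennreal (indicator {a<..<b} s * g s) \<partial>lborel) = (\<integral>\<^sup>+ s. ennreal (g s) * indicator {a<..<b} s \<partial>lborel)"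
      by (rule nn_integral_cong) (auto simp: indicator_def)
    then show "(\<integral>\<^sup>+ s. ennreal (indicator {a<..<b} s * g s) \<partial>lborel) = ennreal r" using eq by simp
  qed (use r in simp_all)
  then have "((\<lambda>s. if s \<in> {a<..<b} then g s else 0) has_integral r) UNIV"
    by (rule has_integral_eq[rotated]) (auto simp: indicator_def)
  then show ?thesis
    by (simp only: has_integral_restrict_UNIV has_integral_Icc_iff_Ioo)
qed

context positive_stable
begin

lemma AE_fractional_equation:
  assumes l: "0 < l"
  shows "AE t in lborel. 0 < t \<longrightarrow>
    (\<integral>\<^sup>+ s. ennreal ((t - s) powr (\<alpha> - 1) * (\<alpha> * (l * s powr - \<alpha> * \<psi> (l * s powr - \<alpha>)))) * indicator {0<..<t} s \<partial>lborel) =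
    (\<integral>\<^sup>+ s. ennreal (Gamma \<alpha> * \<alpha>\<^sup>2 * l * (\<phi> (l * s powr - \<alpha>) / s)) * indicator {0<..<t} s \<partial>lborel)"
proof -
  define K where "K = Gamma \<alpha> * \<alpha>\<^sup>2 * l"
  have K: "0 < K" using \<alpha> l by (simp add: K_def Gamma_real_pos)
  define h where "h s = ennreal (\<alpha> * (l * s powr - \<alpha> * \<psi> (l * s powr - \<alpha>)))" for s
  define g where "g s = ennreal (\<phi> (l * s powr - \<alpha>) / s)" for s
  have [measurable]: "h \<in> borel_measurable borel" "g \<in> borel_measurable borel"
    unfolding h_def g_def by measurable
  let ?L = "\<lambda>t. \<integral>\<^sup>+ s. ennreal ((t - s) powr (\<alpha> - 1)) * h s * indicator {0<..<t} s \<partial>lborel"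
  \<comment> \<open>Integration is written as convolution with a power of exponent
    \<open>1 - 1\<close>, which equals 1 for \<open>s < t\<close>, so that one convolution lemma
    serves both sides.\<close>
  let ?R = "\<lambda>t. \<integral>\<^sup>+ s. ennreal ((t - s) powr (1 - 1)) * (ennreal K * g s) * indicator {0<..<t} s \<partial>lborel"
  define I where "I m = (\<integral>\<^sup>+ w. ennreal (exp (- l * w powr - \<alpha>) * exp (- ((m * w) powr \<alpha>)) / w) * indicator {0<..} w \<partial>lborel)" for m
  have LL: "(\<integral>\<^sup>+ t. ?L t * ennreal (exp (- m * t)) * indicator {0<..} t \<partial>lborel) = ennreal (K / m) * I m" if m: "0 < m" for m
  proof -
    have "(\<integral>\<^sup>+ t. ?L t * ennreal (exp (- m * t)) * indicator {0<..} t \<partial>lborel) =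
      ennreal (Gamma \<alpha> * m powr - \<alpha>) * (ennreal (\<alpha>\<^sup>2 * l * m powr (\<alpha> - 1)) * I m)"
      unfolding I_def laplace_transform_\<psi>[OF l m, symmetric] h_def[symmetric]
      by (rule laplace_transform_convolution_powr) (use \<alpha> m in auto)
    also have "\<dots> = ennreal (Gamma \<alpha> * m powr - \<alpha> * (\<alpha>\<^sup>2 * l * m powr (\<alpha> - 1))) * I m"
      using \<alpha> l m by (simp add: ennreal_mult mult.assoc Gamma_real_nonneg)
    also have "Gamma \<alpha> * m powr - \<alpha> * (\<alpha>\<^sup>2 * l * m powr (\<alpha> - 1)) = K * (m powr - \<alpha> * m powr (\<alpha> - 1))"
      by (simp add: K_def)
    also have "m powr - \<alpha> * m powr (\<alpha> - 1) = 1 / m"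
      using powr_add[of m "- \<alpha>" "\<alpha> - 1"] powr_minus_divide[of m 1] m by simp
    finally show ?thesis by simp
  qed
  have RR: "(\<integral>\<^sup>+ t. ?R t * ennreal (exp (- m * t)) * indicator {0<..} t \<partial>lborel) = ennreal (K / m) * I m" if m: "0 < m" for m
  proof -
    have "(\<integral>\<^sup>+ t. ?R t * ennreal (exp (- m * t)) * indicator {0<..} t \<partial>lborel) =
      ennreal (Gamma 1 * m powr - 1) * (\<integral>\<^sup>+ s. ennreal K * g s * ennreal (exp (- m * s)) * indicator {0<..} s \<partial>lborel)"
      by (rule laplace_transform_convolution_powr) (use m in auto)
    also have "(\<integral>\<^sup>+ s. ennreal K * g s * ennreal (exp (- m * s)) * indicator {0<..} s \<partial>lborel) =
      ennreal K * I m"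
      unfolding I_def laplace_transform_\<phi>[OF l m, symmetric] g_def[symmetric]
      by (simp only: mult.assoc, rule nn_integral_cmult) simp
    also have "ennreal (Gamma 1 * m powr - 1) * (ennreal K * I m) = ennreal (K / m) * I m"
      using m K by (simp add: mult.assoc[symmetric] ennreal_mult[symmetric] powr_minus_divide)
    finally show ?thesis .
  qed
  have "(\<integral>\<^sup>+ s. h s * ennreal (exp (- 1 * s)) * indicator {0<..} s \<partial>lborel) \<le>
    (\<integral>\<^sup>+ s. ennreal \<alpha> * (ennreal (s powr (1 - 1) * exp (- 1 * s)) * indicator {0<..} s) \<partial>lborel)"
  proof (rule nn_integral_mono)
    fix s :: real
    have "h s \<le> ennreal \<alpha>" if "0 < s"
      unfolding h_def using \<alpha> l that mult_\<psi>_le_1[of "l * s powr - \<alpha>"] by (intro ennreal_leI) simp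
    then show "h s * ennreal (exp (- 1 * s)) * indicator {0<..} s \<le> ennreal \<alpha> * (ennreal (s powr (1 - 1) * exp (- 1 * s)) * indicator {0<..} s)"
      by (auto simp: indicator_def intro!: mult_right_mono)
  qed
  also have "\<dots> = ennreal \<alpha> * ennreal (Gamma 1 * 1 powr - 1)"
    by (subst nn_integral_cmult, simp, subst nn_integral_powr_exp) auto
  also have "\<dots> < \<infinity>" by (simp add: ennreal_mult[symmetric])
  finally have fin: "(\<integral>\<^sup>+ t. ?L t * ennreal (exp (- t)) * indicator {0<..} t \<partial>lborel) < \<infinity>"
    using laplace_transform_convolution_powr[of \<alpha> 1 h] \<alpha>
    by (simp add: ennreal_mult_less_top)
  \<comment> \<open>Splitting the indicator of \<open>{0<..<t}\<close> into indicators of fixed sets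
    at \<open>s\<close> and at \<open>t - s\<close> makes the integrand visibly jointly
    measurable.\<close>
  have conv_measurable: "(\<lambda>t. \<integral>\<^sup>+ s. ennreal ((t - s) powr c) * F s * indicator {0<..<t} s \<partial>lborel) \<in> borel_measurable borel"
    if [measurable]: "F \<in> borel_measurable borel" for c :: real and F
  proof -
    have "(\<lambda>t. \<integral>\<^sup>+ s. ennreal ((t - s) powr c) * F s * indicator {0<..<t} s \<partial>lborel) =
      (\<lambda>t. \<integral>\<^sup>+ s. ennreal ((t - s) powr c) * F s * (indicator {0<..} s * indicator {0<..} (t - s)) \<partial>lborel)"
      by (intro ext nn_integral_cong) (auto simp: indicator_def)
    then show ?thesis by simp
  qed
  have "AE t in lborel. 0 < t \<longrightarrow> ?L t = ?R t"
  proof (rule laplace_transform_unique[OF conv_measurable conv_measurable])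
    fix n :: nat
    show "(\<integral>\<^sup>+ t. ?L t * ennreal (exp (- real (Suc n) * t)) * indicator {0<..} t \<partial>lborel) =
      (\<integral>\<^sup>+ t. ?R t * ennreal (exp (- real (Suc n) * t)) * indicator {0<..} t \<partial>lborel)"
      using LL[of "real (Suc n)"] RR[of "real (Suc n)"] by simp
  qed (use fin in simp_all)
  then show ?thesis
  proof eventually_elim
    case (elim t)
    show ?case
    proof
      assume "0 < t"
      with elim have "?L t = ?R t" by simp
      moreover have "?L t = (\<integral>\<^sup>+ s. ennreal ((t - s) powr (\<alpha> - 1) * (\<alpha> * (l * s powr - \<alpha> * \<psi> (l * s powr - \<alpha>)))) * indicator {0<..<t} s \<partial>lborel)"
        using \<alpha> l \<psi>_nonneg by (intro nn_integral_cong) (simp add: h_def ennreal_mult[symmetric])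
      moreover have "?R t = (\<integral>\<^sup>+ s. ennreal (Gamma \<alpha> * \<alpha>\<^sup>2 * l * (\<phi> (l * s powr - \<alpha>) / s)) * indicator {0<..<t} s \<partial>lborel)"
      proof (rule nn_integral_cong)
        fix s :: real
        have "ennreal K * g s = ennreal (K * (\<phi> (l * s powr - \<alpha>) / s))" if "0 < s"
          unfolding g_def using K l that \<phi>_pos[of "l * s powr - \<alpha>"] by (subst ennreal_mult[symmetric]) auto
        then show "ennreal ((t - s) powr (1 - 1)) * (ennreal K * g s) * indicator {0<..<t} s =
          ennreal (Gamma \<alpha> * \<alpha>\<^sup>2 * l * (\<phi> (l * s powr - \<alpha>) / s)) * indicator {0<..<t} s"
          by (auto simp: indicator_def K_def)
      qed
      ultimately show "(\<integral>\<^sup>+ s. ennreal ((t - s) powr (\<alpha> - 1) * (\<alpha> * (l * s powr - \<alpha> * \<psi> (l * s powr - \<alpha>)))) * indicator {0<..<t} s \<partial>lborel) =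
        (\<integral>\<^sup>+ s. ennreal (Gamma \<alpha> * \<alpha>\<^sup>2 * l * (\<phi> (l * s powr - \<alpha>) / s)) * indicator {0<..<t} s \<partial>lborel)"
        by simp
    qed
  qed
qed

text \<open>The substitution \<open>s = t * u\<close> removes \<open>t\<close> from the domain and
  from the singularity. What is left is one fixed kernel, so dominated convergence applies when
  \<open>t\<close> varies.\<close>

lemma nn_integral_fractional_rescale:
  fixes h :: "real \<Rightarrow> real"
  assumes t: "0 < t" and [measurable]: "h \<in> borel_measurable borel"
  shows "(\<integral>\<^sup>+ s. ennreal ((t - s) powr (\<alpha> - 1) * h s) * indicator {0<..<t} s \<partial>lborel) =
    (\<integral>\<^sup>+ u. ennreal (t powr \<alpha> * ((1 - u) powr (\<alpha> - 1) * h (t * u))) * indicator {0<..<1} u \<partial>lborel)"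
proof -
  have "(\<integral>\<^sup>+ s. ennreal ((t - s) powr (\<alpha> - 1) * h s) * indicator {0<..<t} s \<partial>lborel) =
    ennreal \<bar>t\<bar> * (\<integral>\<^sup>+ u. ennreal ((t - (0 + t * u)) powr (\<alpha> - 1) * h (0 + t * u)) * indicator {0<..<t} (0 + t * u) \<partial>lborel)"
    using t by (intro nn_integral_real_affine) auto
  also have "\<dots> = (\<integral>\<^sup>+ u. ennreal \<bar>t\<bar> * (ennreal ((t - (0 + t * u)) powr (\<alpha> - 1) * h (0 + t * u)) * indicator {0<..<t} (0 + t * u)) \<partial>lborel)"
    by (rule nn_integral_cmult[symmetric]) simp
  also have "\<dots> = (\<integral>\<^sup>+ u. ennreal (t powr \<alpha> * ((1 - u) powr (\<alpha> - 1) * h (t * u))) * indicator {0<..<1} u \<partial>lborel)"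
  proof (rule nn_integral_cong)
    fix u :: real
    have ind: "indicator {0<..<t} (0 + t * u) = (indicator {0<..<1} u :: ennreal)"
      using t by (auto simp: indicator_def zero_less_mult_iff)
    have "ennreal t * ennreal ((t - t * u) powr (\<alpha> - 1) * h (t * u)) = ennreal (t powr \<alpha> * ((1 - u) powr (\<alpha> - 1) * h (t * u)))"
      if "u < 1"
    proof -
      have "(t - t * u) powr (\<alpha> - 1) = t powr (\<alpha> - 1) * (1 - u) powr (\<alpha> - 1)"
        using t that by (simp add: powr_mult[symmetric] algebra_simps)
      then have "t * ((t - t * u) powr (\<alpha> - 1) * h (t * u)) = t powr \<alpha> * ((1 - u) powr (\<alpha> - 1) * h (t * u))"
        using t by (simp add: powr_diff)
      then show ?thesis using t by (metis ennreal_mult' less_imp_le)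
    qed
    then show "ennreal \<bar>t\<bar> * (ennreal ((t - (0 + t * u)) powr (\<alpha> - 1) * h (0 + t * u)) * indicator {0<..<t} (0 + t * u)) =
      ennreal (t powr \<alpha> * ((1 - u) powr (\<alpha> - 1) * h (t * u))) * indicator {0<..<1} u"
      unfolding ind using t by (auto simp: indicator_def)
  qed
  finally show ?thesis .
qed

text \<open>Both sides are continuous from the right in \<open>t\<close>, so the identity passes
  from points of validity approaching \<open>t\<close> from the right to \<open>t\<close>
  itself.\<close>

lemma nn_integral_fractional_equation:
  assumes l: "0 < l" and t: "0 < t"
  defines "h \<equiv> \<lambda>s. \<alpha> * (l * s powr - \<alpha> * \<psi> (l * s powr - \<alpha>))"
    and "g \<equiv> \<lambda>s. Gamma \<alpha> * \<alpha>\<^sup>2 * l * (\<phi> (l * s powr - \<alpha>) / s)"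
  shows "(\<integral>\<^sup>+ s. ennreal ((t - s) powr (\<alpha> - 1) * h s) * indicator {0<..<t} s \<partial>lborel) =
      (\<integral>\<^sup>+ s. ennreal (g s) * indicator {0<..<t} s \<partial>lborel)" (is "?L t = ?R t")
    and "(\<integral>\<^sup>+ s. ennreal ((t - s) powr (\<alpha> - 1) * h s) * indicator {0<..<t} s \<partial>lborel) < \<infinity>"
proof -
  have [measurable]: "h \<in> borel_measurable borel" "g \<in> borel_measurable borel"
    unfolding h_def g_def by measurable
  have h: "0 \<le> h s" "h s \<le> \<alpha>" "isCont h s" if "0 < s" for s
  proof -
    show "0 \<le> h s" using \<alpha> l \<psi>_nonneg by (simp add: h_def)
    show "h s \<le> \<alpha>" using \<alpha> l that mult_\<psi>_le_1[of "l * s powr - \<alpha>"] by (simp add: h_def)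
    show "isCont h s" unfolding h_def using l that
      by (intro continuous_intros isCont_o2[OF _ \<psi>_isCont]) auto
  qed
  have AE_eq: "AE t in lborel. 0 < t \<longrightarrow> ?L t = ?R t"
    using AE_fractional_equation[OF l] by (simp only: h_def g_def)
  \<comment> \<open>The bound serves all times up to \<open>t + 2\<close>: the points
    \<open>r n\<close> stay below \<open>t + 1\<close>, and the comparison time \<open>T\<close>
    lies between \<open>t + 1\<close> and \<open>t + 2\<close>.\<close>
  define k where "k u = ennreal ((t + 2) powr \<alpha> * ((1 - u) powr (\<alpha> - 1) * \<alpha>)) * indicator {0<..<1} u" for u :: real
  have k_fin: "(\<integral>\<^sup>+ u. k u \<partial>lborel) < \<infinity>"
  proof -
    have "((\<lambda>u. (t + 2) powr \<alpha> * ((1 - u) powr (\<alpha> - 1) * \<alpha>)) has_integral ((t + 2) powr \<alpha> * ((1 - 0) powr \<alpha> / \<alpha> * \<alpha>))) {0<..<1}"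
      unfolding has_integral_Icc_iff_Ioo[symmetric]
      by (intro has_integral_mult_right has_integral_mult_left has_integral_power_kernel) (use \<alpha> in auto)
    from nn_integral_has_integral_lebesgue'[OF _ this] show ?thesis
      unfolding k_def using \<alpha> t by simp
  qed
  define v where "v t u = ennreal (t powr \<alpha> * ((1 - u) powr (\<alpha> - 1) * h (t * u))) * indicator {0<..<1} u" for t u :: real
  have L: "?L r = (\<integral>\<^sup>+ u. v r u \<partial>lborel)" if "0 < r" for r
    unfolding v_def using that by (rule nn_integral_fractional_rescale) simp
  have vk: "v r u \<le> k u" if "0 < r" "r \<le> t + 2" for r u
  proof -
    have "r powr \<alpha> * ((1 - u) powr (\<alpha> - 1) * h (r * u)) \<le> (t + 2) powr \<alpha> * ((1 - u) powr (\<alpha> - 1) * \<alpha>)" if "0 < u" "u < 1"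
    proof (rule mult_mono)
      show "r powr \<alpha> \<le> (t + 2) powr \<alpha>" using \<open>0 < r\<close> \<open>r \<le> t + 2\<close> \<alpha> by (intro powr_mono2) auto
      show "(1 - u) powr (\<alpha> - 1) * h (r * u) \<le> (1 - u) powr (\<alpha> - 1) * \<alpha>"
        using that \<open>0 < r\<close> h[of "r * u"] by (intro mult_left_mono) auto
    qed (use that \<open>0 < r\<close> h[of "r * u"] in auto)
    then show ?thesis unfolding v_def k_def by (auto simp: indicator_def intro!: ennreal_leI)
  qed
  have L_fin: "?L r < \<infinity>" if "0 < r" "r \<le> t + 2" for r
    unfolding L[OF that(1)] using nn_integral_mono[OF vk[OF that], of lborel] k_fin by (rule order_le_less_trans)
  have "\<exists>r. t < r \<and> r < t + 1 / real (Suc n) \<and> (0 < r \<longrightarrow> ?L r = ?R r)" for n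
  proof -
    obtain r where "t < r" "r < t + 1 / real (Suc n)" "0 < r \<longrightarrow> ?L r = ?R r"
      using AE_eq by (rule AE_lborel_obtains_Ioo[of _ t "t + 1 / real (Suc n)"]) auto
    then show ?thesis by blast
  qed
  then have "\<forall>n. \<exists>r. t < r \<and> r < t + 1 / real (Suc n) \<and> (0 < r \<longrightarrow> ?L r = ?R r)" by (rule allI)
  from choice[OF this] obtain r where "\<forall>n. t < r n \<and> r n < t + 1 / real (Suc n) \<and> (0 < r n \<longrightarrow> ?L (r n) = ?R (r n))" ..
  then have r: "\<And>n. t < r n" "\<And>n. r n < t + 1 / real (Suc n)" "\<And>n. 0 < r n \<longrightarrow> ?L (r n) = ?R (r n)"
    by (rule allE; simp only: simp_thms)+
  have r0: "0 < r n" "r n \<le> t + 1" "r n \<le> t + 2" for n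
  proof -
    have "1 / real (Suc n) \<le> 1" by simp
    then show "0 < r n" "r n \<le> t + 1" "r n \<le> t + 2" using r(1)[of n] r(2)[of n] t by linarith+
  qed
  have r_lim: "r \<longlonglongrightarrow> t"
  proof (rule tendsto_sandwich[OF _ _ tendsto_const])
    show "(\<lambda>n. t + 1 / real (Suc n)) \<longlonglongrightarrow> t"
      using tendsto_add[OF tendsto_const LIMSEQ_inverse_real_of_nat, of t] by (simp add: inverse_eq_divide)
  qed (use r(1,2) in \<open>auto intro!: always_eventually less_imp_le simp del: of_nat_Suc\<close>)
  have "(\<lambda>n. \<integral>\<^sup>+ u. v (r n) u \<partial>lborel) \<longlonglongrightarrow> (\<integral>\<^sup>+ u. v t u \<partial>lborel)"
  proof (rule nn_integral_dominated_convergence[OF _ _ _ _ k_fin])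
    show "AE u in lborel. (\<lambda>n. v (r n) u) \<longlonglongrightarrow> v t u"
    proof (rule AE_I2)
      fix u :: real
      have "(\<lambda>n. r n powr \<alpha> * ((1 - u) powr (\<alpha> - 1) * h (r n * u))) \<longlonglongrightarrow> t powr \<alpha> * ((1 - u) powr (\<alpha> - 1) * h (t * u))" if "0 < u"
        using t that by (intro tendsto_intros r_lim isCont_tendsto_compose[OF h(3)]) auto
      then show "(\<lambda>n. v (r n) u) \<longlonglongrightarrow> v t u"
        unfolding v_def by (cases "u \<in> {0<..<1}") (auto intro!: tendsto_ennrealI)
    qed
  qed (auto simp: v_def[abs_def] k_def[abs_def] vk[OF r0(1,3), unfolded v_def k_def])
  then have lim_L: "(\<lambda>n. ?R (r n)) \<longlonglongrightarrow> ?L t"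
    using r(3) r0 L[OF r0(1)] L[OF t] by simp
  \<comment> \<open>No direct bound on \<open>g\<close> near 0 is at hand. The identity at a time
    \<open>T\<close> beyond every \<open>r n\<close> transfers finiteness from the left side, and
    the integrand cut off at \<open>T\<close> then dominates.\<close>
  obtain T where T: "t + 1 < T" "T < t + 2" "0 < T \<longrightarrow> ?L T = ?R T"
    using AE_eq by (rule AE_lborel_obtains_Ioo[of _ "t + 1" "t + 2"]) auto
  have R_T: "?R T < \<infinity>" using L_fin[of T] T t by simp
  have "(\<lambda>n. ?R (r n)) \<longlonglongrightarrow> ?R t"
  proof (rule nn_integral_dominated_convergence[OF _ _ _ _ R_T])
    show "AE s in lborel. ennreal (g s) * indicator {0<..<r n} s \<le> ennreal (g s) * indicator {0<..<T} s" for n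
      using r0(2)[of n] T by (intro AE_I2 mult_left_mono) (auto simp: indicator_def)
    show "AE s in lborel. (\<lambda>n. ennreal (g s) * indicator {0<..<r n} s) \<longlonglongrightarrow> ennreal (g s) * indicator {0<..<t} s"
      \<comment> \<open>At \<open>s = t\<close> the indicators stay 1 while the limiting indicator
        is 0, so this point is excluded.\<close>
      using AE_lborel_singleton[of t]
    proof eventually_elim
      case (elim s)
      have "\<forall>\<^sub>F n in sequentially. (indicator {0<..<r n} s :: ennreal) = indicator {0<..<t} s"
      proof (cases "s < t")
        case True
        then show ?thesis using r(1) by (intro always_eventually) (auto simp: indicator_def intro: less_trans)
      next
        case False
        then have "t < s" using elim by simp
        then have "\<forall>\<^sub>F n in sequentially. r n < s" by (rule order_tendstoD(2)[OF r_lim])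
        then show ?thesis by eventually_elim (use False in \<open>auto simp: indicator_def\<close>)
      qed
      then show ?case by (intro tendsto_eventually) (auto elim!: eventually_mono)
    qed
  qed auto
  with lim_L show "?L t = ?R t" by (rule LIMSEQ_unique)
  show "?L t < \<infinity>" using L_fin[of t] t by simp
qed

text \<open>Integrability of the right-hand integrand at 0, not evident because of its factor
  \<open>1 / s\<close>, is inherited from the finiteness of the left side.\<close>

theorem fractional_equation:
  assumes l: "0 < l" and t: "0 < t"
  shows "(\<lambda>s. \<phi> (l * s powr - \<alpha>) / s) integrable_on {0..t}" (is "?g integrable_on _")
    and "((\<lambda>s. (t - s) powr (\<alpha> - 1) * (\<alpha> * (l * s powr - \<alpha> * \<psi> (l * s powr - \<alpha>)))) has_integral
      Gamma \<alpha> * \<alpha>\<^sup>2 * l * integral {0..t} (\<lambda>s. \<phi> (l * s powr - \<alpha>) / s)) {0..t}"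
proof -
  define K where "K = Gamma \<alpha> * \<alpha>\<^sup>2 * l"
  have K: "0 < K" using \<alpha> l by (simp add: K_def Gamma_real_pos)
  note eq = nn_integral_fractional_equation[OF l t]
  from eq(2) obtain I where I: "0 \<le> I"
    "(\<integral>\<^sup>+ s. ennreal ((t - s) powr (\<alpha> - 1) * (\<alpha> * (l * s powr - \<alpha> * \<psi> (l * s powr - \<alpha>)))) * indicator {0<..<t} s \<partial>lborel) = ennreal I"
    unfolding infinity_ennreal_def less_top_ennreal by blast
  have "((\<lambda>s. K * ?g s) has_integral I) {0..t}"
    unfolding K_def
    by (rule has_integral_Icc_of_nn_integral)
       (use I eq(1) \<alpha> l in \<open>auto intro!: mult_nonneg_nonneg divide_nonneg_nonneg less_imp_le[OF \<phi>_pos] simp: Gamma_real_nonneg\<close>)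
  from has_integral_mult_right[OF this, of "1 / K"] have g: "(?g has_integral I / K) {0..t}"
    using K by simp
  then show "?g integrable_on {0..t}" by (rule has_integral_integrable)
  have "((\<lambda>s. (t - s) powr (\<alpha> - 1) * (\<alpha> * (l * s powr - \<alpha> * \<psi> (l * s powr - \<alpha>)))) has_integral I) {0..t}"
    by (rule has_integral_Icc_of_nn_integral)
       (use I \<alpha> l \<psi>_nonneg in auto)
  moreover have "K * integral {0..t} ?g = I"
    using integral_unique[OF g] K by simp
  ultimately show "((\<lambda>s. (t - s) powr (\<alpha> - 1) * (\<alpha> * (l * s powr - \<alpha> * \<psi> (l * s powr - \<alpha>)))) has_integral
      Gamma \<alpha> * \<alpha>\<^sup>2 * l * integral {0..t} ?g) {0..t}"
    by (simp only: K_def)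
qed

end

section \<open>Calculus of alternating differences\<close>

lemma alt_diff_const: "alt_diff (\<lambda>_. c) (Suc n) k = 0"
  unfolding alt_diff_Suc by (simp add: alt_diff_def)

lemma alt_diff_of_nat_mult:
  "alt_diff (\<lambda>n. real n * a n) (Suc k) 0 = - real (Suc k) * alt_diff a k 1"
proof -
  have "alt_diff (\<lambda>n. real n * a n) (Suc k) 0 =
    (\<Sum>j\<le>k. (-1) ^ Suc j * real (Suc k choose Suc j) * (real (Suc j) * a (Suc j)))"
    unfolding alt_diff_def by (subst sum.atMost_Suc_shift) simp
  also have "\<dots> = (\<Sum>j\<le>k. - real (Suc k) * ((-1) ^ j * real (k choose j) * a (1 + j)))"
  proof (rule sum.cong)
    fix j
    have "real (Suc j) * real (Suc k choose Suc j) = real (Suc k) * real (k choose j)"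
      using Suc_times_binomial_eq[of k j] by (metis of_nat_mult mult.commute)
    then show "(-1) ^ Suc j * real (Suc k choose Suc j) * (real (Suc j) * a (Suc j)) =
      - real (Suc k) * ((-1) ^ j * real (k choose j) * a (1 + j))"
      by (simp del: of_nat_Suc binomial_Suc_Suc add: mult.assoc mult.left_commute)
  qed simp
  also have "\<dots> = - real (Suc k) * alt_diff a k 1"
    unfolding alt_diff_def by (rule sum_distrib_left[symmetric])
  finally show ?thesis .
qed

text \<open>This is a Leibniz rule: the second differences of an affine factor vanish, so only one
  lower-order term remains. Its minus sign is what makes it a favourable source in the induction
  below.\<close>

lemma alt_diff_affine_mult:
  "alt_diff (\<lambda>n. (l + real n) * a n) (Suc k) 0 = l * alt_diff a (Suc k) 0 - real (Suc k) * alt_diff a k 1"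
proof -
  have "alt_diff (\<lambda>n. (l + real n) * a n) (Suc k) 0 = l * alt_diff a (Suc k) 0 + alt_diff (\<lambda>n. real n * a n) (Suc k) 0"
    unfolding alt_diff_def sum_distrib_left sum.distrib[symmetric]
    by (rule sum.cong) (simp_all add: algebra_simps)
  then show ?thesis by (simp only: alt_diff_of_nat_mult)
qed

lemma alt_diff_mult_left: "alt_diff (\<lambda>n. c * a n) m k = c * alt_diff a m k"
  unfolding alt_diff_def sum_distrib_left by (rule sum.cong) (simp_all add: mult_ac)

lemma alt_diff_has_real_derivative [derivative_intros]:
  assumes "\<And>n. ((\<lambda>s. a n s) has_real_derivative a' n) (at x)"
  shows "((\<lambda>s. alt_diff (\<lambda>n. a n s) m k) has_real_derivative alt_diff a' m k) (at x)"
  unfolding alt_diff_def by (intro DERIV_sum DERIV_cmult assms)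

lemma alt_diff_has_integral:
  assumes "\<And>n. (f n has_integral I n) A"
  shows "((\<lambda>s. alt_diff (\<lambda>n. f n s) m k) has_integral alt_diff I m k) A"
  unfolding alt_diff_def by (intro has_integral_sum has_integral_mult_right assms) auto

section \<open>Complete monotonicity of the quotient\<close>

context positive_stable
begin

lemma \<phi>_tendsto:
  assumes "X \<longlonglongrightarrow> x" "\<And>n. 0 \<le> X n"
  shows "(\<lambda>n. \<phi> (X n)) \<longlonglongrightarrow> \<phi> x"
  unfolding \<phi>_def
  by (rule integral_dominated_convergence[where w = "\<lambda>_. 1"])
     (auto intro!: tendsto_intros assms mult_nonneg_nonneg AE_I2)

lemma \<phi>_at_top: "(\<phi> \<longlongrightarrow> 0) at_top"
proof -
  have "((\<lambda>x. expectation (\<lambda>\<omega>. exp (- x * S \<omega> powr \<alpha>))) \<longlongrightarrow> expectation (\<lambda>\<omega>. 0)) at_top"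
  proof (rule integral_dominated_convergence_at_top[where w = "\<lambda>_. 1"])
    show "\<forall>\<^sub>F x in at_top. AE \<omega> in M. norm (exp (- x * S \<omega> powr \<alpha>)) \<le> 1"
      using eventually_ge_at_top[of 0] by eventually_elim auto
    show "AE \<omega> in M. ((\<lambda>x. exp (- x * S \<omega> powr \<alpha>)) \<longlongrightarrow> 0) at_top"
      using S_pos
    proof eventually_elim
      case (elim \<omega>)
      then have "0 < S \<omega> powr \<alpha>" by simp
      then show ?case by real_asymp
    qed
  qed auto
  then show ?thesis by (simp add: \<phi>_def[abs_def])
qed

text \<open>The value at 0 is the limit from the right, as \<open>\<phi>\<close> tends to 0 at
  infinity. The bare formula would give \<open>\<phi> 0 = 1\<close> there, because
  \<open>0 powr - \<alpha>\<close> is 0.\<close>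

definition \<Phi> :: "real \<Rightarrow> real \<Rightarrow> real" where
  "\<Phi> l s = (if s \<le> 0 then 0 else \<phi> (l * s powr - \<alpha>))"

definition \<Phi>' :: "real \<Rightarrow> real \<Rightarrow> real" where
  "\<Phi>' l s = \<psi> (l * s powr - \<alpha>) * (l * (\<alpha> * s powr (- \<alpha> - 1)))"

lemma \<Phi>_deriv:
  assumes "0 < l" "0 < s"
  shows "(\<Phi> l has_real_derivative \<Phi>' l s) (at s)"
proof -
  have "((\<lambda>s. \<phi> (l * s powr - \<alpha>)) has_real_derivative - \<psi> (l * s powr - \<alpha>) * (l * (- \<alpha> * s powr (- \<alpha> - 1)))) (at s)"
    using assms by (intro DERIV_chain2[OF \<phi>_deriv] derivative_eq_intros) auto
  then have "((\<lambda>s. \<phi> (l * s powr - \<alpha>)) has_real_derivative \<Phi>' l s) (at s)"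
    by (simp add: \<Phi>'_def)
  then show ?thesis
    by (rule has_field_derivative_transform_within_open[of _ _ _ "{0<..}"]) (use assms in \<open>auto simp: \<Phi>_def\<close>)
qed

lemma \<Phi>'_differentiable:
  assumes "0 < l" "0 < s"
  shows "\<Phi>' l differentiable (at s)"
proof -
  have "(\<lambda>s. l * s powr - \<alpha>) differentiable (at s)" "(\<lambda>s. l * (\<alpha> * s powr (- \<alpha> - 1))) differentiable (at s)"
    using assms by (auto simp: real_differentiable_def intro!: exI derivative_eq_intros)
  moreover have "(\<lambda>s. \<psi> (l * s powr - \<alpha>)) differentiable (at s)"
    using differentiable_compose[OF \<psi>_differentiable calculation(1)] assms by simp
  ultimately show ?thesis unfolding \<Phi>'_def[abs_def] using differentiable_mult by blast
qed

lemma \<Phi>_continuous: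
  assumes l: "0 < l" and b: "0 < b"
  shows "continuous_on {0..b} (\<Phi> l)"
  unfolding continuous_on_eq_continuous_within
proof
  fix s assume "s \<in> {0..b}"
  show "continuous (at s within {0..b}) (\<Phi> l)"
  proof (cases "s = 0")
    case False
    then have "0 < s" using \<open>s \<in> {0..b}\<close> by simp
    then show ?thesis using DERIV_isCont[OF \<Phi>_deriv[OF l]] continuous_at_imp_continuous_within by blast
  next
    case True
    have "filterlim (\<lambda>s. l * s powr - \<alpha>) at_top (at_right 0)"
      using \<alpha> l by real_asymp
    then have "((\<lambda>s. \<phi> (l * s powr - \<alpha>)) \<longlongrightarrow> 0) (at_right 0)"
      by (rule filterlim_compose[OF \<phi>_at_top])
    then have "(\<Phi> l \<longlongrightarrow> 0) (at_right 0)"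
      by (rule Lim_transform_eventually) (auto simp: \<Phi>_def eventually_at_right_less intro!: eventually_mono[OF eventually_at_right_less])
    then show ?thesis
      using True by (simp add: continuous_within \<Phi>_def at_within_Icc_at_right[OF b])
  qed
qed

lemma \<Phi>_pos: "\<lbrakk>0 < l; 0 < s\<rbrakk> \<Longrightarrow> 0 < \<Phi> l s"
  by (simp add: \<Phi>_def \<phi>_pos)

lemma \<Phi>_equation:
  assumes l: "0 < l" and t: "0 < t"
  shows "(\<lambda>s. \<Phi> l s / s) integrable_on {0..t}"
    and "((\<lambda>s. (t - s) powr (\<alpha> - 1) * (s * \<Phi>' l s)) has_integral
      Gamma \<alpha> * \<alpha>\<^sup>2 * l * integral {0..t} (\<lambda>s. \<Phi> l s / s)) {0..t}"
    and "((\<lambda>t. integral {0..t} (\<lambda>s. \<Phi> l s / s)) has_real_derivative \<Phi> l t / t) (at t)"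
proof -
  \<comment> \<open>At \<open>s = 0\<close> both quotients are 0 through division by zero.\<close>
  have eq: "\<phi> (l * s powr - \<alpha>) / s = \<Phi> l s / s" if "s \<in> {0..u}" for s u
    using that by (auto simp: \<Phi>_def)
  have int: "(\<lambda>s. \<Phi> l s / s) integrable_on {0..u}" if "0 < u" for u
    using fractional_equation(1)[OF l that] by (rule integrable_eq) (rule eq)
  then show "(\<lambda>s. \<Phi> l s / s) integrable_on {0..t}" using t .
  have "integral {0..t} (\<lambda>s. \<phi> (l * s powr - \<alpha>) / s) = integral {0..t} (\<lambda>s. \<Phi> l s / s)"
    by (rule integral_cong) (rule eq)
  moreover have eq': "(t - s) powr (\<alpha> - 1) * (\<alpha> * (l * s powr - \<alpha> * \<psi> (l * s powr - \<alpha>))) = (t - s) powr (\<alpha> - 1) * (s * \<Phi>' l s)"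
    if "s \<in> {0..t}" for s
  proof (cases "s = 0")
    case False
    then have "s * s powr (- \<alpha> - 1) = s powr - \<alpha>" using that by (simp add: powr_diff)
    then have "s * \<Phi>' l s = \<psi> (l * s powr - \<alpha>) * (l * (\<alpha> * s powr - \<alpha>))"
      unfolding \<Phi>'_def by (metis mult.left_commute)
    then show ?thesis by simp
  qed simp
  ultimately show "((\<lambda>s. (t - s) powr (\<alpha> - 1) * (s * \<Phi>' l s)) has_integral
      Gamma \<alpha> * \<alpha>\<^sup>2 * l * integral {0..t} (\<lambda>s. \<Phi> l s / s)) {0..t}"
    using has_integral_eq[OF eq' fractional_equation(2)[OF l t]] by (simp only:)
  have "isCont (\<lambda>s. \<Phi> l s / s) t"
    using DERIV_isCont[OF \<Phi>_deriv[OF l t]] t by (intro continuous_intros) auto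
  then have "((\<lambda>u. integral {0..u} (\<lambda>s. \<Phi> l s / s)) has_vector_derivative \<Phi> l t / t) (at t within ({0..t + 1} - {}))"
    using t by (intro integral_has_vector_derivative_continuous_at int) (auto intro: continuous_at_imp_continuous_within)
  moreover have "at t within ({0..t + 1} - {}) = at t"
    using t by (intro at_within_interior) (auto simp: interior_atLeastAtMost_real)
  ultimately show "((\<lambda>t. integral {0..t} (\<lambda>s. \<Phi> l s / s)) has_real_derivative \<Phi> l t / t) (at t)"
    by (simp add: has_real_derivative_iff_has_vector_derivative)
qed

text \<open>
  The alternating differences in \<open>l\<close> inherit the fractional equation, with a source term that is the
  next lower difference, so the maximum principle applies inductively.
\<close>

lemma alt_diff_\<Phi>_quotient_nonneg:
  assumes b: "0 < b" and l: "0 < l" and s: "s \<in> {0..b}"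
  shows "0 \<le> alt_diff (\<lambda>n. \<Phi> (l + real n) s / \<Phi> (l + real n) b) k 0"
  using l s
proof (induction k arbitrary: l s)
  case 0
  then show ?case using \<Phi>_pos[of l b] \<Phi>_pos[of l s] b by (cases "s = 0") (auto simp: \<Phi>_def)
next
  case (Suc k)
  note l = Suc.prems(1)
  define \<kappa> where "\<kappa> = Gamma \<alpha> * \<alpha>\<^sup>2"
  have \<kappa>: "0 < \<kappa>" using \<alpha> by (simp add: \<kappa>_def Gamma_real_pos)
  define W where "W n s = \<Phi> (l + real n) s / \<Phi> (l + real n) b" for n s
  define W' where "W' n s = \<Phi>' (l + real n) s / \<Phi> (l + real n) b" for n s
  define Q where "Q n t = \<kappa> * ((l + real n) * (integral {0..t} (\<lambda>s. \<Phi> (l + real n) s / s) / \<Phi> (l + real n) b))" for n t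
  \<comment> \<open>The sign is reversed because the maximum principle bounds from above.\<close>
  define V where "V s = - alt_diff (\<lambda>n. W n s) (Suc k) 0" for s
  define V' where "V' s = - alt_diff (\<lambda>n. W' n s) (Suc k) 0" for s
  define J where "J t = - alt_diff (\<lambda>n. Q n t) (Suc k) 0" for t
  have ln: "0 < l + real n" for n using l by simp
  have "V s \<le> 0"
  proof (rule fractional_maximum_principle[where V = V and V' = V' and J = J and a = \<alpha> and b = b])
    show "continuous_on {0..b} V"
      unfolding V_def alt_diff_def W_def using \<Phi>_pos[OF ln b]
      by (intro continuous_intros \<Phi>_continuous ln b) (auto simp: less_imp_neq[THEN not_sym])
    show "V 0 \<le> 0" by (simp add: V_def W_def \<Phi>_def alt_diff_def)
    have "W n b = 1" for n using \<Phi>_pos[OF ln b, of n] by (simp add: W_def)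
    then show "V b \<le> 0" by (simp add: V_def alt_diff_const)
    fix t assume t: "0 < t" "t < b"
    show "(V has_real_derivative V' t) (at t)"
      unfolding V_def V'_def W_def W'_def
      by (intro DERIV_minus alt_diff_has_real_derivative DERIV_cdivide \<Phi>_deriv ln t)
    show "V' differentiable (at t)"
      unfolding V'_def alt_diff_def W'_def divide_inverse
      by (intro differentiable_minus differentiable_sum ballI differentiable_mult differentiable_const \<Phi>'_differentiable ln t finite_atMost)
    have QI: "((\<lambda>s. (t - s) powr (\<alpha> - 1) * (s * W' n s)) has_integral Q n t) {0..t}" for n
    proof -
      have "((\<lambda>s. (t - s) powr (\<alpha> - 1) * (s * \<Phi>' (l + real n) s) / \<Phi> (l + real n) b) has_integral
        Gamma \<alpha> * \<alpha>\<^sup>2 * (l + real n) * integral {0..t} (\<lambda>s. \<Phi> (l + real n) s / s) / \<Phi> (l + real n) b) {0..t}"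
        by (rule has_integral_divide[OF \<Phi>_equation(2)[OF ln[of n] t(1)]])
      then show ?thesis
        by (simp only: W'_def Q_def \<kappa>_def mult.assoc times_divide_eq_right)
    qed
    have "((\<lambda>s. alt_diff (\<lambda>n. (t - s) powr (\<alpha> - 1) * (s * W' n s)) (Suc k) 0) has_integral alt_diff (\<lambda>n. Q n t) (Suc k) 0) {0..t}"
      by (rule alt_diff_has_integral) (rule QI)
    then have "((\<lambda>s. - alt_diff (\<lambda>n. (t - s) powr (\<alpha> - 1) * (s * W' n s)) (Suc k) 0) has_integral J t) {0..t}"
      unfolding J_def by (rule has_integral_neg)
    then show "((\<lambda>s. (t - s) powr (\<alpha> - 1) * (s * V' s)) has_integral J t) {0..t}"
      by (simp only: V'_def alt_diff_mult_left mult_minus_right)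
    assume pos: "0 < V t"
    \<comment> \<open>Index 1 at parameter \<open>l\<close> is index 0 at parameter
      \<open>l + 1\<close>, which is why the induction runs over all \<open>l\<close>.\<close>
    have IH: "0 \<le> alt_diff (\<lambda>n. W n t) k 1"
      using Suc.IH[of "l + 1" t] l t by (simp add: alt_diff_def W_def add.assoc)
    have "(J has_real_derivative - alt_diff (\<lambda>n. \<kappa> * ((l + real n) * (\<Phi> (l + real n) t / t / \<Phi> (l + real n) b))) (Suc k) 0) (at t)"
      unfolding J_def Q_def
      by (intro DERIV_minus alt_diff_has_real_derivative DERIV_cmult DERIV_cdivide \<Phi>_equation(3) ln t)
    moreover have "(\<lambda>n. \<kappa> * ((l + real n) * (\<Phi> (l + real n) t / t / \<Phi> (l + real n) b))) = (\<lambda>n. \<kappa> / t * ((l + real n) * W n t))"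
      using t by (auto simp: W_def)
    then have "- alt_diff (\<lambda>n. \<kappa> * ((l + real n) * (\<Phi> (l + real n) t / t / \<Phi> (l + real n) b))) (Suc k) 0 =
      \<kappa> / t * (l * V t + real (Suc k) * alt_diff (\<lambda>n. W n t) k 1)"
      by (simp only: alt_diff_mult_left alt_diff_affine_mult V_def) (simp add: algebra_simps)
    \<comment> \<open>Strictness comes from \<open>V t > 0\<close> and \<open>l > 0\<close>; the
      source term from the induction hypothesis is only nonnegative.\<close>
    moreover have "0 < \<kappa> / t * (l * V t + real (Suc k) * alt_diff (\<lambda>n. W n t) k 1)"
      using \<kappa> t l pos IH by (intro mult_pos_pos add_pos_nonneg divide_pos_pos) auto
    ultimately show "\<exists>r>0. (J has_real_derivative r) (at t)" by auto
  qed (use \<alpha> b Suc.prems in auto)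
  then show ?case by (simp add: V_def W_def)
qed

theorem alt_diff_\<phi>_quotient_nonneg:
  assumes c: "0 < c" "c < 1"
  shows "0 \<le> alt_diff (\<lambda>i. \<phi> (real i) / \<phi> (c * real i)) n k"
proof -
  define b where "b = c powr (- 1 / \<alpha>)"
  have b: "1 < b" "b powr - \<alpha> = c"
  proof -
    show "b powr - \<alpha> = c" using c \<alpha> by (simp add: b_def powr_powr)
    have "1 powr (- 1 / \<alpha>) < c powr (- 1 / \<alpha>)" using c \<alpha> by (intro powr_less_mono2_neg) auto
    then show "1 < b" by (simp add: b_def)
  qed
  \<comment> \<open>The offset \<open>k\<close> is absorbed into the parameter of the previous
    lemma. That parameter must be positive, and the additional \<open>l\<close> ensures this when
    \<open>k = 0\<close>.\<close>
  have pos: "0 \<le> alt_diff (\<lambda>i. \<phi> (real (k + i) + l) / \<phi> (c * (real (k + i) + l))) n 0" if "0 < l" for l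
  proof -
    have "0 \<le> alt_diff (\<lambda>i. \<Phi> (real k + l + real i) 1 / \<Phi> (real k + l + real i) b) n 0"
      using that b by (intro alt_diff_\<Phi>_quotient_nonneg) auto
    moreover have "(\<lambda>i. \<Phi> (real k + l + real i) 1 / \<Phi> (real k + l + real i) b) = (\<lambda>i. \<phi> (real (k + i) + l) / \<phi> (c * (real (k + i) + l)))"
      using b by (auto simp: \<Phi>_def algebra_simps)
    ultimately show ?thesis by (simp only:)
  qed
  \<comment> \<open>Letting the shift tend to 0 reaches the integers themselves; continuity of
    \<open>\<phi>\<close> along nonnegative sequences covers the argument 0 as well.\<close>
  define e where "e m = inverse (real (Suc m))" for m
  have e: "0 < e m" for m by (simp add: e_def)
  have e_lim: "e \<longlonglongrightarrow> 0" unfolding e_def by (rule LIMSEQ_inverse_real_of_nat)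
  have "(\<lambda>m. alt_diff (\<lambda>i. \<phi> (real (k + i) + e m) / \<phi> (c * (real (k + i) + e m))) n 0) \<longlonglongrightarrow>
    alt_diff (\<lambda>i. \<phi> (real (k + i) + 0) / \<phi> (c * (real (k + i) + 0))) n 0"
    unfolding alt_diff_def
  proof (intro tendsto_intros \<phi>_tendsto e_lim)
    fix i show "\<phi> (c * (real (k + (0 + i)) + 0)) \<noteq> 0" using \<phi>_pos[of "c * real (k + i)"] c by simp
  qed (use c e in \<open>auto intro!: add_nonneg_nonneg mult_nonneg_nonneg simp: less_imp_le\<close>)
  then have "0 \<le> alt_diff (\<lambda>i. \<phi> (real (k + i) + 0) / \<phi> (c * (real (k + i) + 0))) n 0"
    by (rule LIMSEQ_le_const) (use pos[OF e] in blast)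
  then show ?thesis by (simp add: alt_diff_def)
qed

end

section \<open>Construction of the independent summand\<close>

context positive_stable
begin

lemma self_decomposable_powr: "self_decomposable M (\<lambda>\<omega>. S \<omega> powr \<alpha>)"
  unfolding self_decomposable_def
proof (intro conjI allI impI)
  show "prob_space M" by (rule prob_space_axioms)
  show [measurable]: "(\<lambda>\<omega>. S \<omega> powr \<alpha>) \<in> borel_measurable M" by measurable
  fix c :: real assume c: "0 < c \<and> c < 1"
  define \<mu> where "\<mu> = distr M borel (\<lambda>\<omega>. S \<omega> powr \<alpha>)"
  interpret \<mu>: real_distribution \<mu> unfolding \<mu>_def by (rule real_distribution_distr) simp
  have [measurable_cong]: "sets \<mu> = sets borel" by simp
  have \<mu>_pos: "AE x in \<mu>. 0 \<le> x" unfolding \<mu>_def by (subst AE_distr_iff) auto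
  have \<phi>_\<mu>: "(\<integral>x. exp (- x * y) \<partial>\<mu>) = \<phi> y" for y
    unfolding \<mu>_def \<phi>_def by (subst integral_distr) (auto simp: mult.commute)
  obtain T :: "real measure" where T: "real_distribution T" "AE x in T. x \<in> {0..1}"
    and T_moments: "\<And>k. (\<integral>x. x ^ k \<partial>T) = \<phi> (real k) / \<phi> (c * real k)"
    using hausdorff_moment_problem[of "\<lambda>i. \<phi> (real i) / \<phi> (c * real i)"] alt_diff_\<phi>_quotient_nonneg c by auto
  interpret T: real_distribution T by (rule T(1))
  have [measurable_cong]: "sets T = sets borel" by simp
  \<comment> \<open>The first coordinate is the copy of \<open>S powr \<alpha>\<close> and the
    second plays the role of \<open>exp (- Y)\<close>; the product measure makes them
    independent.\<close>
  define N where "N = \<mu> \<Otimes>\<^sub>M T"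
  interpret N: pair_prob_space \<mu> T ..
  have sets_N [measurable_cong]: "sets N = sets (borel \<Otimes>\<^sub>M borel)" unfolding N_def by (intro sets_pair_measure_cong) auto
  have N: "prob_space N" unfolding N_def by (rule N.prob_space_axioms)
  interpret N': prob_space N by (rule N)
  have fst_N: "distr N borel fst = \<mu>"
    unfolding N_def using T.distr_pair_fst[of \<mu>] by (simp cong: distr_cong)
  have snd_N: "distr N borel snd = T"
  proof -
    have "distr N borel snd = distr (distr (T \<Otimes>\<^sub>M \<mu>) (\<mu> \<Otimes>\<^sub>M T) (\<lambda>(x, y). (y, x))) borel snd"
      unfolding N_def by (subst N.distr_pair_swap) simp
    also have "\<dots> = distr (T \<Otimes>\<^sub>M \<mu>) borel fst"
      by (subst distr_distr) (auto simp: comp_def case_prod_beta)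
    also have "\<dots> = distr (T \<Otimes>\<^sub>M \<mu>) T fst" by (rule distr_cong) auto
    also have "\<dots> = T" by (rule \<mu>.distr_pair_fst)
    finally show ?thesis .
  qed
  have indep: "N'.indep_var borel fst borel snd"
    unfolding N'.indep_var_distribution_eq
    using distr_id2[OF sets_N[symmetric]] by (simp add: fst_N snd_N N_def[symmetric])
  have AE_N: "AE p in N. 0 \<le> fst p" "AE p in N. snd p \<in> {0..1}"
  proof -
    show "AE p in N. 0 \<le> fst p" using \<mu>_pos unfolding fst_N[symmetric] by (subst (asm) AE_distr_iff) auto
    show "AE p in N. snd p \<in> {0..1}" using T(2) unfolding snd_N[symmetric] by (subst (asm) AE_distr_iff) auto
  qed
  \<comment> \<open>\<open>Z\<close> stands for \<open>exp (- (c * X' + Y))\<close>. It is kept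
    multiplicative because \<open>T\<close> might so far have an atom at 0, where no meaningful
    logarithm exists. In its moments the factor \<open>\<phi> (c * real k)\<close> cancels the
    denominator of the moments of \<open>T\<close>.\<close>
  define Z where "Z p = exp (- c * fst p) * snd p" for p :: "real \<times> real"
  have [measurable]: "Z \<in> borel_measurable N" unfolding Z_def by measurable
  have Z_distr: "distr N borel Z = distr \<mu> borel (\<lambda>x. exp (- x))"
  proof (rule moments_determine_distribution)
    show "real_distribution (distr N borel Z)" by (rule N'.real_distribution_distr) simp
    show "real_distribution (distr \<mu> borel (\<lambda>x. exp (- x)))" by (rule \<mu>.real_distribution_distr) simp
    show "AE x in distr N borel Z. x \<in> {0..1}"
      using AE_N c by (subst AE_distr_iff) (auto simp: Z_def mult_le_one)
    show "AE x in distr \<mu> borel (\<lambda>x. exp (- x)). x \<in> {0..1}"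
      using \<mu>_pos by (subst AE_distr_iff) auto
    fix k :: nat
    have "(\<integral>x. x ^ k \<partial>distr N borel Z) = (\<integral>p. exp (- fst p * (c * real k)) * snd p ^ k \<partial>N)"
      by (subst integral_distr) (auto simp: Z_def power_mult_distrib exp_of_nat_mult[symmetric] mult_ac)
    also have "\<dots> = (\<integral>x. exp (- x * (c * real k)) \<partial>\<mu>) * (\<integral>x. x ^ k \<partial>T)"
    proof -
      let ?f = "\<lambda>x. exp (- x * (c * real k))" and ?g = "\<lambda>x :: real. x ^ k"
      have ind: "N'.indep_var borel (?f \<circ> fst) borel (?g \<circ> snd)"
        by (rule N'.indep_var_compose[OF indep]) auto
      have "integrable N (?f \<circ> fst)"
        using AE_N(1) c by (intro N'.integrable_const_bound[where B = 1]) (auto simp: comp_def)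
      moreover have "integrable N (?g \<circ> snd)"
      proof (rule N'.integrable_const_bound[where B = 1])
        show "AE p in N. norm ((?g \<circ> snd) p) \<le> 1"
          using AE_N(2) by eventually_elim (auto simp: power_le_one)
      qed (simp add: comp_def)
      ultimately have "(\<integral>p. (?f \<circ> fst) p * (?g \<circ> snd) p \<partial>N) = (\<integral>p. (?f \<circ> fst) p \<partial>N) * (\<integral>p. (?g \<circ> snd) p \<partial>N)"
        by (rule N'.indep_var_lebesgue_integral[OF ind])
      also have "(\<integral>p. (?f \<circ> fst) p \<partial>N) = (\<integral>x. ?f x \<partial>\<mu>)"
        unfolding fst_N[symmetric] by (subst integral_distr) (auto simp: comp_def)
      also have "(\<integral>p. (?g \<circ> snd) p \<partial>N) = (\<integral>x. ?g x \<partial>T)"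
        unfolding snd_N[symmetric] by (subst integral_distr) (auto simp: comp_def)
      finally show ?thesis by (simp only: comp_def)
    qed
    also have "\<dots> = \<phi> (real k)"
      using \<phi>_pos[of "c * real k"] c by (simp only: \<phi>_\<mu> T_moments) simp
    also have "\<dots> = (\<integral>x. x ^ k \<partial>distr \<mu> borel (\<lambda>x. exp (- x)))"
      unfolding \<phi>_\<mu>[symmetric]
      by (subst integral_distr) (auto simp: exp_of_nat_mult[symmetric] mult_ac)
    finally show "(\<integral>x. x ^ k \<partial>distr N borel Z) = (\<integral>x. x ^ k \<partial>distr \<mu> borel (\<lambda>x. exp (- x)))" .
  qed
  \<comment> \<open>The law just identified lives on positive numbers, which rules out an atom of
    \<open>T\<close> at 0. Only now does the logarithm split the product into a sum.\<close>
  have "AE z in distr N borel Z. z \<noteq> 0"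
    unfolding Z_distr by (subst AE_distr_iff) auto
  then have "AE p in N. Z p \<noteq> 0" by (subst (asm) AE_distr_iff) auto
  with AE_N have ln_Z: "AE p in N. - ln (Z p) = c * fst p + - ln (snd p)"
    by eventually_elim (auto simp: Z_def ln_mult)
  have "\<mu> = distr (distr \<mu> borel (\<lambda>x. exp (- x))) borel (\<lambda>x. - ln x)"
    by (subst distr_distr) (auto simp: comp_def intro!: distr_id2[symmetric])
  also have "\<dots> = distr N borel (\<lambda>p. - ln (Z p))"
    unfolding Z_distr[symmetric] by (subst distr_distr) (auto simp: comp_def)
  also have "\<dots> = distr N borel (\<lambda>p. c * fst p + - ln (snd p))"
    using ln_Z by (intro distr_cong_AE) auto
  finally have sum: "\<mu> = distr N borel (\<lambda>p. c * fst p + - ln (snd p))" .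
  have "N'.indep_var borel (id \<circ> fst) borel ((\<lambda>x. - ln x) \<circ> snd)"
    by (rule N'.indep_var_compose[OF indep]) auto
  then have "N'.indep_var borel fst borel (\<lambda>p. - ln (snd p))"
    by (simp add: comp_def)
  then show "\<exists>(N :: (real \<times> real) measure) X' Y. prob_space N \<and> prob_space.indep_var N borel X' borel Y \<and>
      distr N borel X' = distr M borel (\<lambda>\<omega>. S \<omega> powr \<alpha>) \<and>
      distr M borel (\<lambda>\<omega>. S \<omega> powr \<alpha>) = distr N borel (\<lambda>\<omega>. c * X' \<omega> + Y \<omega>)"
    using N fst_N sum unfolding \<mu>_def by blast
qed

end

theorem mainTheorem3:
  fixes \<alpha> :: real and M :: "'a measure" and S :: "'a \<Rightarrow> real"
  assumes "0 < \<alpha>" and "\<alpha> < 1"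
    and "positive_stable_rv \<alpha> M S"
  shows "positive_rv M (\<lambda>\<omega>. S \<omega> powr \<alpha>) \<and> self_decomposable M (\<lambda>\<omega>. S \<omega> powr \<alpha>)"
proof -
  from assms(3) have S: "prob_space M" "S \<in> borel_measurable M" "AE \<omega> in M. 0 < S \<omega>"
    "\<And>l. 0 \<le> l \<Longrightarrow> prob_space.expectation M (\<lambda>\<omega>. exp (- l * S \<omega>)) = exp (- (l powr \<alpha>))"
    by (auto simp: positive_stable_rv_def positive_rv_def)
  interpret prob_space M by (rule S(1))
  interpret positive_stable M S \<alpha>
    by unfold_locales (use assms(1,2) S in auto)
  show ?thesis
  proof
    show "positive_rv M (\<lambda>\<omega>. S \<omega> powr \<alpha>)"
      unfolding positive_rv_def using S_pos prob_space_axioms by auto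
    show "self_decomposable M (\<lambda>\<omega>. S \<omega> powr \<alpha>)" by (rule self_decomposable_powr)
  qed
qed

end
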